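(* Let $G$ be a finite non-trivial step-2 nilpotent group in which $g^2$ is central for every $g\in G$. Then the automata group $\mathcal G(\mathcal C(G))$ generated by the Cayley machine of $G$ is a cross-wired lamplighter group.
   Context: "Step-2 nilpotent" means that all commutators of $G$ are central in $G$ (the abelian case is included). Cayley machine: for a non-trivial finite group $G$, the Cayley machine $\mathcal C(G)$ is the automaton with state set $G$ and alphabet $G$ which, in state $g_0$ on reading input letter $g$, moves to state $g_0g$ and outputs $g_0g$. Each state $g\in G$ defines a bijection $\mathcal C(G)_g$ of the set $G^\omega$ of right-infinite words over $G$, namely $\mathcal C(G)_g(a_0,a_1,a_2,\ldots)=(ga_0,\,ga_0a_1,\,ga_0a_1a_2,\ldots)$. The automata group $\mathcal G(\mathcal C(G))$ is the group of bijections of $G^\omega$ generated by all $\mathcal C(G)_g$, $g\in G$, with product given by composition. Diestel-Leader graphs: for integers $m,n\ge 2$ let $T_1,T_2$ be the regular trees of valency $m+1$ and $n+1$, each with a fixed end and an associated Busemann (height) function $b_i:T_i\to\mathbb Z$ on vertices, so that each vertex $v$ of $T_1$ (resp. $T_2$) has exactly one neighbour with height $b_i(v)-1$ and $m$ (resp. $n$) neighbours with height $b_i(v)+1$. The Diestel-Leader graph $DL(m,n)$ has vertex set $\{(v,w)\in T_1\times T_2 : b_1(v)+b_2(w)=0\}$, with $(v,w)$ and $(v',w')$ adjacent if and only if $v,v'$ are adjacent in $T_1$ and $w,w'$ are adjacent in $T_2$. Its isometry group is a locally compact group with the topology of pointwise convergence. A cross-wired lamplighter group is a (discrete) group isomorphic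 to a cocompact lattice in the isometry group of some Diestel-Leader graph. *)

theory Defs
  imports "HOL-Analysis.Analysis" "HOL-Algebra.Bij" "HOL-Algebra.Elementary_Groups"
begin

section \<open>Step-2 nilpotent groups\<close>

definition group_center :: "('a, 'b) monoid_scheme \<Rightarrow> 'a set" where
  "group_center G = {z \<in> carrier G. \<forall>x \<in> carrier G. z \<otimes>\<^bsub>G\<^esub> x = x \<otimes>\<^bsub>G\<^esub> z}"

text \<open>\<open>derived_set G (carrier G)\<close> is the set of all commutators
  \<open>x y x\<^sup>-\<^sup>1 y\<^sup>-\<^sup>1\<close>, not the subgroup they generate.  Abelian groups are included.\<close>

definition step2_nilpotent :: "('a, 'b) monoid_scheme \<Rightarrow> bool" where
  "step2_nilpotent G \<longleftrightarrow> group G \<and> derived_set G (carrier G) \<subseteq> group_center G"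


section \<open>Automata groups and the Cayley machine\<close>

text \<open>Letter-to-letter automata with the same input and output alphabet.\<close>

record ('q, 'a) automaton =
  states :: "'q set"
  alphabet :: "'a set"
  next_state :: "'q \<Rightarrow> 'a \<Rightarrow> 'q"
  out_letter :: "'q \<Rightarrow> 'a \<Rightarrow> 'a"

definition omega_words :: "'a set \<Rightarrow> (nat \<Rightarrow> 'a) set" where
  "omega_words A = {a. \<forall>n. a n \<in> A}"

primrec state_after :: "('q, 'a) automaton \<Rightarrow> 'q \<Rightarrow> (nat \<Rightarrow> 'a) \<Rightarrow> nat \<Rightarrow> 'q" where
  "state_after M q a 0 = q"
| "state_after M q a (Suc n) = next_state M (state_after M q a n) (a n)"

definition state_action :: "('q, 'a) automaton \<Rightarrow> 'q \<Rightarrow> (nat \<Rightarrow> 'a) \<Rightarrow> (nat \<Rightarrow> 'a)" where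
  "state_action M q =
     (\<lambda>a \<in> omega_words (alphabet M). \<lambda>n. out_letter M (state_after M q a n) (a n))"

text \<open>Meant for automata whose states all act by bijections, as is the case for the Cayley
  machine (see below): \<open>subgroup_generated\<close> discards generators outside the carrier.\<close>

definition automata_group :: "('q, 'a) automaton \<Rightarrow> ((nat \<Rightarrow> 'a) \<Rightarrow> (nat \<Rightarrow> 'a)) monoid" where
  "automata_group M =
     subgroup_generated (BijGroup (omega_words (alphabet M))) (state_action M ` states M)"

definition cayley_machine :: "('a, 'b) monoid_scheme \<Rightarrow> ('a, 'a) automaton" where
  "cayley_machine G = \<lparr>states = carrier G, alphabet = carrier G,
     next_state = (\<lambda>g a. g \<otimes>\<^bsub>G\<^esub> a), out_letter = (\<lambda>g a. g \<otimes>\<^bsub>G\<^esub> a)\<rparr>"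

lemma cayley_machine_simps [simp]:
  "states (cayley_machine G) = carrier G"
  "alphabet (cayley_machine G) = carrier G"
  "next_state (cayley_machine G) = (\<lambda>g a. g \<otimes>\<^bsub>G\<^esub> a)"
  "out_letter (cayley_machine G) = (\<lambda>g a. g \<otimes>\<^bsub>G\<^esub> a)"
  by (simp_all add: cayley_machine_def)

text \<open>The explicit form \<open>(a\<^sub>0, a\<^sub>1, \<dots>) \<mapsto> (g a\<^sub>0, g a\<^sub>0 a\<^sub>1, \<dots>)\<close>
  of the action of a state \<open>g\<close>.\<close>

lemma cayley_action_0:
  assumes "a \<in> omega_words (carrier G)"
  shows "state_action (cayley_machine G) g a 0 = g \<otimes>\<^bsub>G\<^esub> a 0"
  using assms by (simp add: state_action_def)

lemma cayley_action_Suc: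
  assumes "a \<in> omega_words (carrier G)"
  shows "state_action (cayley_machine G) g a (Suc n) =
           state_action (cayley_machine G) g a n \<otimes>\<^bsub>G\<^esub> a (Suc n)"
  using assms by (simp add: state_action_def)

lemma (in group) cayley_action_closed:
  assumes "g \<in> carrier G" "a \<in> omega_words (carrier G)"
  shows "state_action (cayley_machine G) g a n \<in> carrier G"
proof (induction n)
  case 0
  then show ?case using assms by (simp add: cayley_action_0 omega_words_def)
next
  case (Suc n)
  then show ?case using assms by (simp add: cayley_action_Suc omega_words_def)
qed

lemma (in group) cayley_action_Bij:
  assumes g: "g \<in> carrier G"
  shows "state_action (cayley_machine G) g \<in> Bij (omega_words (carrier G))"
proof -
  let ?W = "omega_words (carrier G)" and ?f = "state_action (cayley_machine G) g"
  have "inj_on ?f ?W"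
  proof (rule inj_onI)
    fix a b assume ab: "a \<in> ?W" "b \<in> ?W" "?f a = ?f b"
    have "a n = b n" for n
    proof (cases n)
      case 0
      have "g \<otimes> a 0 = g \<otimes> b 0" using ab cayley_action_0 by metis
      then show ?thesis using 0 ab g by (simp add: omega_words_def)
    next
      case (Suc k)
      have "?f a k \<otimes> a (Suc k) = ?f a k \<otimes> b (Suc k)" using ab cayley_action_Suc by metis
      then show ?thesis using Suc ab g cayley_action_closed[OF g ab(1), of k]
        by (simp add: omega_words_def)
    qed
    then show "a = b" by auto
  qed
  moreover have "?f ` ?W = ?W"
  proof
    show "?f ` ?W \<subseteq> ?W" using cayley_action_closed[OF g] by (auto simp: omega_words_def)
    show "?W \<subseteq> ?f ` ?W"
    proof
      fix b assume b: "b \<in> ?W"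
      define a where "a n = (case n of 0 \<Rightarrow> inv g \<otimes> b 0 | Suc k \<Rightarrow> inv (b k) \<otimes> b (Suc k))" for n
      have a: "a \<in> ?W" using b g by (auto simp: omega_words_def a_def split: nat.split)
      have a0: "a 0 = inv g \<otimes> b 0" and aS: "a (Suc k) = inv (b k) \<otimes> b (Suc k)" for k
        by (simp_all add: a_def)
      have bc: "b n \<in> carrier G" for n using b by (simp add: omega_words_def)
      have "?f a n = b n" for n
      proof (induction n)
        case 0
        then show ?case using g bc by (simp add: cayley_action_0[OF a] a0 m_assoc[symmetric])
      next
        case (Suc n)
        then show ?case using bc by (simp add: cayley_action_Suc[OF a] aS m_assoc[symmetric])
      qed
      then have "?f a = b" by auto
      then show "b \<in> ?f ` ?W" using a by blast
    qed
  qed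
  ultimately show ?thesis by (simp add: Bij_def bij_betw_def state_action_def)
qed


section \<open>Graphs, trees and Busemann functions\<close>

record 'v sgraph =
  vertices :: "'v set"
  adj :: "'v rel"

definition simple_graph :: "'v sgraph \<Rightarrow> bool" where
  "simple_graph X \<longleftrightarrow> adj X \<subseteq> vertices X \<times> vertices X \<and> sym (adj X) \<and> irrefl (adj X)"

definition connected_graph :: "'v sgraph \<Rightarrow> bool" where
  "connected_graph X \<longleftrightarrow>
     vertices X \<noteq> {} \<and> (\<forall>x \<in> vertices X. \<forall>y \<in> vertices X. (x, y) \<in> (adj X)\<^sup>*)"

definition graph_cycle :: "'v sgraph \<Rightarrow> 'v list \<Rightarrow> bool" where
  "graph_cycle X c \<longleftrightarrow> length c \<ge> 3 \<and> distinct c \<and>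
     successively (\<lambda>x y. (x, y) \<in> adj X) c \<and> (last c, hd c) \<in> adj X"

definition tree :: "'v sgraph \<Rightarrow> bool" where
  "tree X \<longleftrightarrow> simple_graph X \<and> connected_graph X \<and> (\<nexists>c. graph_cycle X c)"

text \<open>The valency is used only for positive \<open>k\<close>, so infinite neighbourhoods (whose \<open>card\<close>
  is 0) are excluded.\<close>

definition regular_tree :: "nat \<Rightarrow> 'v sgraph \<Rightarrow> bool" where
  "regular_tree k X \<longleftrightarrow> tree X \<and> (\<forall>v \<in> vertices X. card {w. (v, w) \<in> adj X} = k)"

text \<open>Length of a shortest path; only meaningful for vertices in the same component.\<close>

definition graph_dist :: "'v sgraph \<Rightarrow> 'v \<Rightarrow> 'v \<Rightarrow> nat" where
  "graph_dist X x y = (LEAST n. (x, y) \<in> adj X ^^ n)"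

definition ray :: "'v sgraph \<Rightarrow> (nat \<Rightarrow> 'v) \<Rightarrow> bool" where
  "ray X \<xi> \<longleftrightarrow> inj \<xi> \<and> (\<forall>n. (\<xi> n, \<xi> (Suc n)) \<in> adj X)"

text \<open>An end of a tree is a class of rays that eventually coincide up to a shift.  A Busemann
  function of that end is \<open>b v = lim (d(v, \<xi> n) - n)\<close> for a ray \<open>\<xi>\<close> representing it.  It
  depends on the representative only by an additive constant, and all integer constants occur.
  With this sign the neighbour closer to the end has height one less, and the others have height
  one more.\<close>

definition busemann_function :: "'v sgraph \<Rightarrow> ('v \<Rightarrow> int) \<Rightarrow> bool" where
  "busemann_function X b \<longleftrightarrow> (\<exists>\<xi>. ray X \<xi> \<and>
     (\<forall>v \<in> vertices X. (\<lambda>n. int (graph_dist X v (\<xi> n)) - int n) \<longlonglongrightarrow> b v))"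


section \<open>Diestel-Leader graphs and their isometry groups\<close>

definition horocyclic_product ::
  "'v sgraph \<Rightarrow> ('v \<Rightarrow> int) \<Rightarrow> 'w sgraph \<Rightarrow> ('w \<Rightarrow> int) \<Rightarrow> ('v \<times> 'w) sgraph" where
  "horocyclic_product T1 b1 T2 b2 =
     (let V = {(v, w). v \<in> vertices T1 \<and> w \<in> vertices T2 \<and> b1 v + b2 w = 0}
      in \<lparr>vertices = V,
          adj = {((v, w), (v', w')). (v, w) \<in> V \<and> (v', w') \<in> V \<and>
                   (v, v') \<in> adj T1 \<and> (w, w') \<in> adj T2}\<rparr>)"

text \<open>The trees are countable and unique up to height-preserving isomorphism, so the vertices
  may be taken to be natural numbers; this determines \<open>DL(m, n)\<close> up to isomorphism.\<close>

definition diestel_leader_graph :: "nat \<Rightarrow> nat \<Rightarrow> (nat \<times> nat) sgraph \<Rightarrow> bool" where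
  "diestel_leader_graph m n X \<longleftrightarrow> m \<ge> 2 \<and> n \<ge> 2 \<and>
     (\<exists>T1 b1 T2 b2. regular_tree (m + 1) T1 \<and> busemann_function T1 b1 \<and>
        regular_tree (n + 1) T2 \<and> busemann_function T2 b2 \<and>
        X = horocyclic_product T1 b1 T2 b2)"

definition isometries :: "'v sgraph \<Rightarrow> ('v \<Rightarrow> 'v) set" where
  "isometries X = {f \<in> Bij (vertices X).
     \<forall>x \<in> vertices X. \<forall>y \<in> vertices X. graph_dist X (f x) (f y) = graph_dist X x y}"

definition isometry_group :: "'v sgraph \<Rightarrow> ('v \<Rightarrow> 'v) monoid" where
  "isometry_group X = BijGroup (vertices X)\<lparr>carrier := isometries X\<rparr>"

definition pointwise_topology :: "'v sgraph \<Rightarrow> ('v \<Rightarrow> 'v) topology" where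
  "pointwise_topology X =
     subtopology (product_topology (\<lambda>_. discrete_topology (vertices X)) (vertices X))
       (isometries X)"

lemma topspace_pointwise_topology: "topspace (pointwise_topology X) = isometries X"
  by (auto simp: pointwise_topology_def isometries_def Bij_def bij_betw_def PiE_def)

lemma subgroup_isometries: "subgroup (isometries X) (BijGroup (vertices X))"
proof -
  let ?V = "vertices X"
  interpret B: group "BijGroup ?V" by (rule group_BijGroup)
  show ?thesis
  proof (rule B.subgroupI)
    show "isometries X \<subseteq> carrier (BijGroup ?V)"
      by (auto simp: isometries_def BijGroup_def)
    have "(\<lambda>x\<in>?V. x) \<in> isometries X" by (simp add: isometries_def id_Bij)
    then show "isometries X \<noteq> {}" by blast
  next
    fix f assume f: "f \<in> isometries X"
    then have fB: "f \<in> Bij ?V" by (simp add: isometries_def)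
    then have im: "f ` ?V = ?V" by (simp add: Bij_def bij_betw_def)
    have "graph_dist X (inv_into ?V f x) (inv_into ?V f y) = graph_dist X x y"
      if "x \<in> ?V" "y \<in> ?V" for x y
    proof -
      have "inv_into ?V f x \<in> ?V" "inv_into ?V f y \<in> ?V"
        using that im by (auto intro: inv_into_into)
      moreover have "f (inv_into ?V f x) = x" "f (inv_into ?V f y) = y"
        using that im by (simp_all add: f_inv_into_f)
      ultimately show ?thesis using f by (force simp: isometries_def)
    qed
    then show "inv\<^bsub>BijGroup ?V\<^esub> f \<in> isometries X"
      using fB by (simp add: inv_BijGroup isometries_def restrict_inv_into_Bij)
  next
    fix f g assume fg: "f \<in> isometries X" "g \<in> isometries X"
    then have B: "f \<in> Bij ?V" "g \<in> Bij ?V" by (simp_all add: isometries_def)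
    then have "g x \<in> ?V" if "x \<in> ?V" for x
      using that by (auto simp: Bij_def bij_betw_def)
    then show "f \<otimes>\<^bsub>BijGroup ?V\<^esub> g \<in> isometries X"
      using fg B by (simp add: BijGroup_def isometries_def compose_Bij compose_eq)
  qed
qed

lemma group_isometry_group: "group (isometry_group X)"
  unfolding isometry_group_def
  by (rule subgroup.subgroup_is_group[OF subgroup_isometries group_BijGroup])


section \<open>Cocompact lattices and cross-wired lamplighter groups\<close>

definition quotient_topology :: "'a topology \<Rightarrow> ('a \<Rightarrow> 'b) \<Rightarrow> 'b topology" where
  "quotient_topology X q =
     topology (\<lambda>U. U \<subseteq> q ` topspace X \<and> openin X {x \<in> topspace X. q x \<in> U})"

lemma openin_quotient_topology:
  "openin (quotient_topology X q) U \<longleftrightarrow>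
     U \<subseteq> q ` topspace X \<and> openin X {x \<in> topspace X. q x \<in> U}"
proof -
  have "istopology (\<lambda>U. U \<subseteq> q ` topspace X \<and> openin X {x \<in> topspace X. q x \<in> U})"
    unfolding istopology_def
  proof (intro conjI allI impI; (elim conjE)?)
    fix S T
    assume "openin X {x \<in> topspace X. q x \<in> S}" "openin X {x \<in> topspace X. q x \<in> T}"
    then have "openin X ({x \<in> topspace X. q x \<in> S} \<inter> {x \<in> topspace X. q x \<in> T})" by blast
    also have "{x \<in> topspace X. q x \<in> S} \<inter> {x \<in> topspace X. q x \<in> T} =
                 {x \<in> topspace X. q x \<in> S \<inter> T}" by blast
    finally show "openin X {x \<in> topspace X. q x \<in> S \<inter> T}" .
  next
    fix K assume K: "\<forall>S\<in>K. S \<subseteq> q ` topspace X \<and> openin X {x \<in> topspace X. q x \<in> S}"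
    then have "openin X (\<Union>S\<in>K. {x \<in> topspace X. q x \<in> S})" by blast
    also have "(\<Union>S\<in>K. {x \<in> topspace X. q x \<in> S}) = {x \<in> topspace X. q x \<in> \<Union>K}" by blast
    finally show "openin X {x \<in> topspace X. q x \<in> \<Union>K}" .
  qed blast+
  then show ?thesis by (simp add: quotient_topology_def topology_inverse')
qed

lemma quotient_map_quotient_topology: "quotient_map X (quotient_topology X q) q"
proof -
  have "topspace (quotient_topology X q) = q ` topspace X"
  proof
    show "topspace (quotient_topology X q) \<subseteq> q ` topspace X"
      using openin_topspace[of "quotient_topology X q"]
      by (simp only: openin_quotient_topology)
    have "{x \<in> topspace X. q x \<in> q ` topspace X} = topspace X" by blast
    then have "openin (quotient_topology X q) (q ` topspace X)"
      by (simp add: openin_quotient_topology)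
    then show "q ` topspace X \<subseteq> topspace (quotient_topology X q)" by (rule openin_subset)
  qed
  then show ?thesis by (auto simp: quotient_map_def openin_quotient_topology)
qed

text \<open>For a locally compact group \<open>H\<close> with topology \<open>T\<close>: \<open>L\<close> is a discrete subgroup and the
  space \<open>H/L\<close> of cosets \<open>h L\<close> is compact in the quotient topology.\<close>

definition cocompact_lattice ::
  "('a, 'b) monoid_scheme \<Rightarrow> 'a topology \<Rightarrow> 'a set \<Rightarrow> bool" where
  "cocompact_lattice H T L \<longleftrightarrow> subgroup L H \<and>
     subtopology T L = discrete_topology L \<and>
     compact_space (quotient_topology T (\<lambda>h. h <#\<^bsub>H\<^esub> L))"

definition cross_wired_lamplighter :: "('a, 'b) monoid_scheme \<Rightarrow> bool" where
  "cross_wired_lamplighter \<Gamma> \<longleftrightarrow> group \<Gamma> \<and>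
     (\<exists>m n X L. diestel_leader_graph m n X \<and>
        cocompact_lattice (isometry_group X) (pointwise_topology X) L \<and>
        \<Gamma> \<cong> isometry_group X\<lparr>carrier := L\<rparr>)"

end

theory Submission
  imports Defs
begin

text \<open>Let \<open>T\<close> be the prefix-product map, the action of the state \<open>\<one>\<close>; a state \<open>g\<close> acts as \<open>T\<close> after
  left multiplication of the first letter by \<open>g\<close>.  As commutators are central of order at most two,
  \<open>(u \<star> a)\<^sub>n = u\<^sub>n a\<^sub>n \<Prod>\<^bsub>i<n\<^esub> [a\<^sub>i, u\<^bsub>2n-1-i\<^esub> u\<^bsub>2n-i\<^esub>]\<close> is a group law on \<open>G\<^sup>\<omega>\<close> of which \<open>T\<close> is an
  automorphism, and multiplying the first letter by \<open>g\<close> is the left translation by \<open>(g, 1, 1, \<dots>)\<close>.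
  The words trivial from position \<open>n\<close> on form a subgroup \<open>F n\<close> of order \<open>|G|\<^sup>n\<close>, and \<open>T\<^sup>-\<^sup>1\<close> shifts the
  last nontrivial position by exactly one.  Hence \<open>A = \<Union>n. F n\<close> is contracted by conjugation with
  \<open>T\<^sup>-\<^sup>1\<close>, \<open>B = \<Union>n. T\<^sup>n F n T\<^sup>-\<^sup>n\<close> is contracted by conjugation with \<open>T\<close>, \<open>A\<close> and \<open>B\<close> intersect trivially,
  and \<open>A B\<close> is the kernel of the height homomorphism to the integers.  The cosets of \<open>A\<close> and of \<open>B\<close> are
  the vertices of two trees, and the group acts simply transitively on their horocyclic product.\<close>

section \<open>Trees defined by a parent map\<close>

text \<open>For abelian \<open>G\<close> the pointwise product would do. In general, comparing the
  prefix products of \<open>u_0 a_0, u_1 a_1, ...\<close> with those of \<open>u\<close> and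
  \<open>a\<close> means moving \<open>u_(n+1)\<close> past \<open>a_0 ... a_n\<close>, at the cost
  of the commutator \<open>[a_0 ... a_n, u_(n+1)]\<close>; a central correction \<open>C u a\<close>
  has to absorb this defect. Two demands shape it. It is bimultiplicative, because such a central
  map is a 2-cocycle and associativity follows. And it vanishes at position \<open>n\<close> once
  \<open>u\<close> is trivial from \<open>n\<close> on, so that the finitely supported words are
  filtered by subgroups and translation by \<open>(g, 1, 1, ...)\<close> changes the first letter
  only. Pairing \<open>a_i\<close> with the adjacent letters of \<open>u\<close> at
  \<open>2n-1-i\<close> and \<open>2n-i\<close> does both: as \<open>i < n\<close>, only positions
  \<open>n\<close> to \<open>2n\<close> of \<open>u\<close> occur. Commutators of order at most two
  let \<open>T\<close> collapse such a pair to a single letter, after which the defect telescopes.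
  Both branching numbers of the resulting Diestel-Leader graph equal the order of
  \<open>G\<close>.\<close>

definition parent_graph :: "'v set \<Rightarrow> ('v \<Rightarrow> 'v) \<Rightarrow> 'v sgraph" where
  "parent_graph V p =
     \<lparr>vertices = V, adj = {(v, w). v \<in> V \<and> w \<in> V \<and> (w = p v \<or> v = p w)}\<rparr>"

lemma graph_dist_le: "(x, y) \<in> adj X ^^ n \<Longrightarrow> graph_dist X x y \<le> n"
  unfolding graph_dist_def by (rule Least_le)

lemma graph_dist_relpow: "(x, y) \<in> (adj X)\<^sup>* \<Longrightarrow> (x, y) \<in> adj X ^^ graph_dist X x y"
  unfolding graph_dist_def by (metis LeastI_ex rtrancl_power)

text \<open>The fixed end is the common limit of the ancestor lines: by
  \<open>common_ancestor\<close> any two of them merge, which gives connectedness and lets the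
  Busemann limit be computed along one of them. The height excludes cycles.\<close>

locale leveled_tree =
  fixes V :: "'v set" and p :: "'v \<Rightarrow> 'v" and b :: "'v \<Rightarrow> int" and q :: nat
  assumes p_closed: "v \<in> V \<Longrightarrow> p v \<in> V"
    and b_p: "v \<in> V \<Longrightarrow> b (p v) = b v - 1"
    and card_children: "v \<in> V \<Longrightarrow> card {w \<in> V. p w = v} = q"
    and q_pos: "q > 0"
    and common_ancestor: "v \<in> V \<Longrightarrow> w \<in> V \<Longrightarrow> \<exists>i j. (p ^^ i) v = (p ^^ j) w"
    and b_zero: "\<exists>v \<in> V. b v = 0"
begin

abbreviation X where "X \<equiv> parent_graph V p"

lemma vertices_X [simp]: "vertices X = V"
  by (simp add: parent_graph_def)

lemma adj_iff: "(v, w) \<in> adj X \<longleftrightarrow> v \<in> V \<and> w \<in> V \<and> (w = p v \<or> v = p w)"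
  by (simp add: parent_graph_def)

lemma funpow_closed: "v \<in> V \<Longrightarrow> (p ^^ i) v \<in> V"
  by (induction i) (simp_all add: p_closed)

lemma b_funpow: "v \<in> V \<Longrightarrow> b ((p ^^ i) v) = b v - int i"
  by (induction i) (simp_all add: b_p funpow_closed)

lemma simple: "simple_graph X"
proof -
  have "v \<noteq> p v" if "v \<in> V" for v using b_p[OF that] by auto
  then show ?thesis
    by (auto simp: simple_graph_def adj_iff sym_def irrefl_def)
qed

lemma relpow_funpow: "v \<in> V \<Longrightarrow> (v, (p ^^ i) v) \<in> adj X ^^ i"
proof (induction i)
  case (Suc i)
  then have "((p ^^ i) v, (p ^^ Suc i) v) \<in> adj X"
    using funpow_closed[of v i] p_closed by (auto simp: adj_iff)
  then show ?case using Suc by auto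
qed simp

lemma sym_adj: "sym (adj X)"
  using simple by (simp add: simple_graph_def)

lemma connected: "connected_graph X"
  unfolding connected_graph_def
proof (intro conjI ballI)
  show "vertices X \<noteq> {}" using b_zero by auto
  fix x y assume "x \<in> vertices X" "y \<in> vertices X"
  then have xy: "x \<in> V" "y \<in> V" by simp_all
  then obtain i j where ij: "(p ^^ i) x = (p ^^ j) y" using common_ancestor by blast
  have "(x, (p ^^ i) x) \<in> (adj X)\<^sup>*" "(y, (p ^^ j) y) \<in> (adj X)\<^sup>*"
    using relpow_funpow xy by (meson relpow_imp_rtrancl)+
  then show "(x, y) \<in> (adj X)\<^sup>*"
    using ij sym_rtrancl[OF sym_adj] by (metis rtrancl_trans symD)
qed

text \<open>A vertex of maximal height on a cycle has its parent as both cyclic neighbours.\<close>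

lemma acyclic: "\<not> graph_cycle X c"
proof
  assume c: "graph_cycle X c"
  define n where "n = length c"
  have n: "n \<ge> 3" and d: "distinct c" and s: "successively (\<lambda>x y. (x, y) \<in> adj X) c"
    and l: "(last c, hd c) \<in> adj X"
    using c by (simp_all add: graph_cycle_def n_def)
  have step: "(c ! i, c ! (Suc i mod n)) \<in> adj X" if "i < n" for i
  proof (cases "Suc i < n")
    case True
    then show ?thesis using s by (simp add: successively_conv_nth n_def)
  next
    case False
    then have "i = n - 1" "Suc i mod n = 0" using that n by (auto simp: not_less le_Suc_eq)
    moreover have "c \<noteq> []" using n n_def by auto
    ultimately show ?thesis using l by (simp add: last_conv_nth hd_conv_nth n_def)
  qed
  have "finite (b ` set c)" "b ` set c \<noteq> {}" using n n_def by auto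
  then have "Max (b ` set c) \<in> b ` set c" by (rule Max_in)
  then obtain i where i: "i < n" "b (c ! i) = Max (b ` set c)"
    by (metis image_iff in_set_conv_nth n_def)
  have le: "b (c ! j) \<le> b (c ! i)" if "j < n" for j
    using that i by (simp add: n_def)
  \<comment> \<open>\<open>j\<close> is the cyclic predecessor of \<open>i\<close>; adding
    \<open>n - 1\<close> avoids truncated subtraction.\<close>
  define j where "j = (i + (n - 1)) mod n"
  define k where "k = Suc i mod n"
  have jk: "j < n" "k < n" using n by (simp_all add: j_def k_def)
  have ji: "Suc j mod n = i" using n i by (simp add: j_def mod_Suc_eq)
  \<comment> \<open>Here \<open>n \<ge> 3\<close> matters: in a closed walk of length 2, predecessor
    and successor coincide.\<close>
  have "j \<noteq> k"
  proof
    assume "j = k"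
    then have "Suc (Suc i) mod n = i" using ji k_def by (simp add: mod_Suc_eq)
    then show False using n i
      by (metis (no_types, lifting) One_nat_def Suc_1 Suc_le_eq mod_Suc mod_less n_not_Suc_n
          not_less_eq numeral_3_eq_3 less_Suc_eq not_less_less_Suc_eq)
  qed
  have "(c ! i, c ! k) \<in> adj X" "(c ! j, c ! i) \<in> adj X"
    using step[OF i(1)] step[OF jk(1)] ji by (simp_all add: k_def)
  then have "c ! k = p (c ! i)" "c ! j = p (c ! i)"
    using le[OF jk(1)] le[OF jk(2)] b_p by (force simp: adj_iff)+
  then have "c ! j = c ! k" by simp
  then show False using \<open>j \<noteq> k\<close> d jk by (simp add: nth_eq_iff_index_eq n_def)
qed

lemma neighbours: "v \<in> V \<Longrightarrow> {w. (v, w) \<in> adj X} = insert (p v) {w \<in> V. p w = v}"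
  using p_closed by (auto simp: adj_iff)

lemma regular: "regular_tree (q + 1) X"
  unfolding regular_tree_def tree_def
proof (intro conjI ballI)
  fix v assume "v \<in> vertices X"
  then have v: "v \<in> V" by simp
  \<comment> \<open>The parent is not also a child, so the count is \<open>q\<close> plus
    one.\<close>
  have "p (p v) \<noteq> v" using b_p[OF v] b_p[OF p_closed[OF v]] by auto
  moreover have "finite {w \<in> V. p w = v}"
    using card_children[OF v] q_pos card_ge_0_finite by metis
  ultimately show "card {w. (v, w) \<in> adj X} = q + 1"
    unfolding neighbours[OF v] by (simp add: card_children[OF v])
qed (use simple connected acyclic in auto)

text \<open>A lower bound for distances; it shows that climbing along \<open>p\<close> is a shortest
  path.\<close>

lemma height_relpow: "(x, y) \<in> adj X ^^ n \<Longrightarrow> b x - b y \<le> int n"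
proof (induction n arbitrary: y)
  case (Suc n)
  then obtain z where "(x, z) \<in> adj X ^^ n" "(z, y) \<in> adj X" by auto
  then show ?case using Suc.IH[of z] b_p by (force simp: adj_iff)
qed simp

text \<open>The ray is the ancestor line of a vertex of height 0. Once the line of \<open>v\<close>
  has merged with it, climbing is a shortest path from \<open>v\<close> to \<open>\<xi> n\<close>,
  so the sequence is constant with value \<open>b v\<close>.\<close>

lemma busemann: "busemann_function X b"
proof -
  obtain o' where o: "o' \<in> V" "b o' = 0" using b_zero by blast
  define \<xi> where "\<xi> n = (p ^^ n) o'" for n
  have b\<xi>: "b (\<xi> n) = - int n" and \<xi>V: "\<xi> n \<in> V" for n
    using o b_funpow funpow_closed by (simp_all add: \<xi>_def)
  have "inj \<xi>" by (rule injI) (metis b\<xi> neg_equal_iff_equal of_nat_eq_iff)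
  moreover have "(\<xi> n, \<xi> (Suc n)) \<in> adj X" for n
    using \<xi>V[of n] \<xi>V[of "Suc n"] by (simp add: adj_iff \<xi>_def)
  ultimately have "ray X \<xi>" by (simp add: ray_def)
  moreover have "(\<lambda>n. int (graph_dist X v (\<xi> n)) - int n) \<longlonglongrightarrow> b v" if v: "v \<in> V" for v
  proof (rule tendsto_eventually)
    obtain i j where ij: "(p ^^ i) v = (p ^^ j) o'" using common_ancestor v o by blast
    then have bv: "b v - int i = - int j" using b_funpow[OF v, of i] b_funpow[OF o(1), of j] o by simp
    have "int (graph_dist X v (\<xi> n)) - int n = b v" if n: "n \<ge> j" for n
    proof -
      have "\<xi> n = (p ^^ (n - j)) ((p ^^ i) v)"
        using n by (simp add: ij \<xi>_def flip: funpow_add comp_apply[of "p ^^ _" "p ^^ _"])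
      then have "\<xi> n = (p ^^ (n - j + i)) v" by (simp add: funpow_add)
      then have rel: "(v, \<xi> n) \<in> adj X ^^ (n - j + i)" using relpow_funpow[OF v] by metis
      then have "graph_dist X v (\<xi> n) \<le> n - j + i" by (rule graph_dist_le)
      moreover have "b v - b (\<xi> n) \<le> int (graph_dist X v (\<xi> n))"
        using rel by (intro height_relpow graph_dist_relpow) (rule relpow_imp_rtrancl)
      ultimately show ?thesis using bv b\<xi>[of n] n by linarith
    qed
    then show "\<forall>\<^sub>F n in sequentially. int (graph_dist X v (\<xi> n)) - int n = b v"
      by (auto simp: eventually_sequentially)
  qed
  ultimately show ?thesis unfolding busemann_function_def vertices_X by blast
qed

end


section \<open>Simply transitive groups of isometries\<close>

lemma finite_relpow_image:
  fixes R :: "'a rel"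
  assumes "\<And>v. finite {w. (v, w) \<in> R}"
  shows "finite {w. (x, w) \<in> R ^^ n}"
proof (induction n)
  case (Suc n)
  have "{w. (x, w) \<in> R ^^ Suc n} = (\<Union>v \<in> {v. (x, v) \<in> R ^^ n}. {w. (v, w) \<in> R})" by auto
  then show ?case using Suc assms by simp
qed simp

lemma isometries_mult:
  assumes "f \<in> isometries X" "g \<in> isometries X"
  shows "f \<otimes>\<^bsub>isometry_group X\<^esub> g = compose (vertices X) f g"
  using assms by (simp add: isometry_group_def BijGroup_def isometries_def)

lemma isometries_closed: "f \<in> isometries X \<Longrightarrow> x \<in> vertices X \<Longrightarrow> f x \<in> vertices X"
  by (auto simp: isometries_def Bij_def bij_betw_def)

lemma carrier_isometry_group [simp]: "carrier (isometry_group X) = isometries X"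
  by (simp add: isometry_group_def)

lemma graph_dist_eq_0:
  assumes "(x, y) \<in> (adj X)\<^sup>*"
  shows "graph_dist X x y = 0 \<longleftrightarrow> x = y"
proof
  assume "graph_dist X x y = 0"
  then show "x = y" using graph_dist_relpow[OF assms] by simp
next
  assume "x = y"
  then have "(x, y) \<in> adj X ^^ 0" by simp
  then show "graph_dist X x y = 0" using graph_dist_le[of x y 0 X] by simp
qed

locale locally_finite_graph =
  fixes X :: "'v sgraph"
  assumes connected: "connected_graph X"
    and adj_vertices: "adj X \<subseteq> vertices X \<times> vertices X"
    and locally_finite: "\<And>v. finite {w. (v, w) \<in> adj X}"
begin

lemma finite_sphere: "x \<in> vertices X \<Longrightarrow> finite {z \<in> vertices X. graph_dist X x z = d}"
  by (rule finite_subset[OF _ finite_relpow_image[OF locally_finite, of x d]])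
    (use connected graph_dist_relpow in \<open>force simp: connected_graph_def\<close>)

text \<open>Preserving distances gives injectivity. Surjectivity comes sphere by sphere: an
  injective self-map of a finite set is onto.\<close>

lemma isometry_of_stabilizer:
  assumes x: "x \<in> vertices X" and f: "f \<in> (\<Pi>\<^sub>E y \<in> vertices X. {z \<in> vertices X. graph_dist X x z = graph_dist X x y})"
    and iso: "\<And>y z. y \<in> vertices X \<Longrightarrow> z \<in> vertices X \<Longrightarrow> graph_dist X (f y) (f z) = graph_dist X y z"
  shows "f \<in> isometries X"
proof -
  let ?V = "vertices X"
  have fV: "f y \<in> ?V" "graph_dist X x (f y) = graph_dist X x y" if "y \<in> ?V" for y
    using f that by (auto simp: PiE_iff)
  have inj: "inj_on f ?V"
  proof (rule inj_onI)
    fix y z assume yz: "y \<in> ?V" "z \<in> ?V" "f y = f z"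
    then have "graph_dist X y z = graph_dist X (f y) (f y)" using iso by metis
    also have "\<dots> = 0" by (simp add: graph_dist_eq_0)
    finally show "y = z" using yz connected graph_dist_eq_0[of y z X] by (simp add: connected_graph_def)
  qed
  have "f ` ?V = ?V"
  proof
    show "?V \<subseteq> f ` ?V"
    proof
      fix y assume y: "y \<in> ?V"
      let ?S = "{z \<in> ?V. graph_dist X x z = graph_dist X x y}"
      have "f ` ?S \<subseteq> ?S" using fV by auto
      moreover have "inj_on f ?S" using inj by (rule inj_on_subset) auto
      ultimately have "f ` ?S = ?S" using finite_sphere[OF x] by (simp add: endo_inj_surj)
      then show "y \<in> f ` ?V" using y by blast
    qed
  qed (use fV in auto)
  then show ?thesis
    using inj f iso by (auto simp: isometries_def Bij_def bij_betw_def PiE_iff)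
qed

text \<open>The stabilizer is a product of finite spheres, compact by Tychonoff, cut down by closed
  conditions that each involve two coordinates.\<close>

lemma compactin_stabilizer:
  assumes x: "x \<in> vertices X"
  shows "compactin (pointwise_topology X) {f \<in> isometries X. f x = x}"
proof -
  let ?V = "vertices X"
  let ?P = "product_topology (\<lambda>_. discrete_topology ?V) ?V"
  let ?S = "\<lambda>y. {z \<in> ?V. graph_dist X x z = graph_dist X x y}"
  define D where "D = (\<lambda>(y, z). {f \<in> topspace ?P. graph_dist X (f y) (f z) = graph_dist X y z})"
  \<comment> \<open>Coordinates are discrete, so every relation between two of them is open. It is
    applied to the negated distance equation, which makes \<open>D yz\<close> closed.\<close>
  have op: "openin ?P {f \<in> topspace ?P. R (f y) (f z)}" if yz: "y \<in> ?V" "z \<in> ?V" for y z R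
  proof -
    have o1: "openin ?P {f \<in> topspace ?P. f w = c}" if "w \<in> ?V" for w c
    proof -
      have "continuous_map ?P (discrete_topology ?V) (\<lambda>f. f w)"
        using that by (rule continuous_map_product_projection)
      then have "openin ?P {f \<in> topspace ?P. f w \<in> {c} \<inter> ?V}"
        by (rule openin_continuous_map_preimage) simp
      moreover have "{f \<in> topspace ?P. f w \<in> {c} \<inter> ?V} = {f \<in> topspace ?P. f w = c}"
        using that by (auto simp: PiE_iff)
      ultimately show ?thesis by simp
    qed
    have "{f \<in> topspace ?P. R (f y) (f z)} =
        (\<Union>(c, d) \<in> {(c, d). R c d}. {f \<in> topspace ?P. f y = c} \<inter> {f \<in> topspace ?P. f z = d})"
      by auto
    also have "openin ?P \<dots>" using o1 yz by (intro openin_Union) (auto intro!: openin_Int)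
    finally show ?thesis .
  qed
  have cl: "closedin ?P (D yz)" if V2: "yz \<in> ?V \<times> ?V" for yz
  proof -
    obtain y z where yz: "yz = (y, z)" "y \<in> ?V" "z \<in> ?V" using V2 by blast
    have "topspace ?P - D yz = {f \<in> topspace ?P. graph_dist X (f y) (f z) \<noteq> graph_dist X y z}"
      by (auto simp: D_def yz)
    then show ?thesis unfolding closedin_def using op[OF yz(2,3), of "\<lambda>a b. graph_dist X a b \<noteq> graph_dist X y z"]
      by (auto simp: D_def yz)
  qed
  have "{f \<in> isometries X. f x = x} = Pi\<^sub>E ?V ?S \<inter> (\<Inter>yz \<in> ?V \<times> ?V. D yz)"
  proof (intro equalityI subsetI)
    fix f assume "f \<in> {f \<in> isometries X. f x = x}"
    then have f: "f \<in> isometries X" "f x = x" by auto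
    then have dist: "graph_dist X (f y) (f z) = graph_dist X y z" if "y \<in> ?V" "z \<in> ?V" for y z
      using that by (simp add: isometries_def)
    have ext: "f \<in> extensional ?V" using f by (simp add: isometries_def Bij_def)
    have fV: "f y \<in> ?V" if "y \<in> ?V" for y using f that isometries_closed by metis
    show "f \<in> Pi\<^sub>E ?V ?S \<inter> (\<Inter>yz \<in> ?V \<times> ?V. D yz)"
      using ext fV dist dist[OF x] f(2) by (auto simp: PiE_iff D_def)
  next
    fix f assume f: "f \<in> Pi\<^sub>E ?V ?S \<inter> (\<Inter>yz \<in> ?V \<times> ?V. D yz)"
    \<comment> \<open>The sphere that contains its own centre has radius 0, so the product condition
      already forces \<open>f x = x\<close>.\<close>
    have "f x \<in> ?S x" using f x by (auto simp: PiE_iff)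
    then have "graph_dist X x (f x) = 0" by (simp add: graph_dist_eq_0)
    then have "f x = x" using \<open>f x \<in> ?S x\<close> x connected graph_dist_eq_0[of x "f x" X]
      by (simp add: connected_graph_def)
    moreover have "f \<in> isometries X"
      using f by (intro isometry_of_stabilizer[OF x]) (auto simp: D_def)
    ultimately show "f \<in> {f \<in> isometries X. f x = x}" by simp
  qed
  moreover have "compactin ?P (Pi\<^sub>E ?V ?S)"
    using finite_sphere[OF x] by (subst compactin_PiE) (auto simp: compactin_discrete_topology)
  moreover have "closedin ?P (\<Inter>yz \<in> ?V \<times> ?V. D yz)"
    using cl x by (intro closedin_Inter) auto
  ultimately have "compactin ?P {f \<in> isometries X. f x = x}"
    by (simp add: compact_Int_closedin)
  then show ?thesis by (auto simp: pointwise_topology_def compactin_subtopology)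
qed

text \<open>Evaluation at \<open>x\<close> is continuous into a discrete space and injective on
  \<open>L\<close>, so \<open>L\<close> is discrete. By transitivity every coset meets the
  stabilizer of \<open>x\<close>, so the coset space is a continuous image of a compact set.\<close>

lemma simply_transitive_cocompact_lattice:
  assumes L: "subgroup L (isometry_group X)" and x: "x \<in> vertices X"
    and trans: "\<And>y. y \<in> vertices X \<Longrightarrow> \<exists>f \<in> L. f x = y"
    and free: "\<And>f g. f \<in> L \<Longrightarrow> g \<in> L \<Longrightarrow> f x = g x \<Longrightarrow> f = g"
  shows "cocompact_lattice (isometry_group X) (pointwise_topology X) L"
  unfolding cocompact_lattice_def
proof (intro conjI)
  let ?V = "vertices X" and ?I = "isometry_group X" and ?T = "pointwise_topology X"
  let ?P = "product_topology (\<lambda>_. discrete_topology ?V) ?V"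
  let ?q = "\<lambda>h. h <#\<^bsub>?I\<^esub> L"
  interpret I: group ?I by (rule group_isometry_group)
  have LI: "L \<subseteq> isometries X" using subgroup.subset[OF L] by simp
  show "subgroup L ?I" by (rule L)
  have "openin (subtopology ?T L) {f}" if f: "f \<in> L" for f
  proof -
    have "continuous_map ?T (discrete_topology ?V) (\<lambda>h. h x)"
      unfolding pointwise_topology_def
      by (rule continuous_map_from_subtopology[OF continuous_map_product_projection[OF x]])
    then have "openin ?T {h \<in> topspace ?T. h x \<in> {f x}}"
      by (rule openin_continuous_map_preimage) (use f LI isometries_closed[of f X x] x in auto)
    then have "openin (subtopology ?T L) (L \<inter> {h \<in> topspace ?T. h x \<in> {f x}})"
      by (rule openin_subtopology_Int2)
    moreover have "L \<inter> {h \<in> topspace ?T. h x \<in> {f x}} = {f}"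
      using f LI free by (auto simp: topspace_pointwise_topology)
    ultimately show ?thesis by simp
  qed
  then have "discrete_topology L = subtopology ?T L"
    using LI by (subst discrete_topology_unique) (auto simp: topspace_pointwise_topology)
  then show "subtopology ?T L = discrete_topology L" by simp
  have q: "quotient_map ?T (quotient_topology ?T ?q) ?q" by (rule quotient_map_quotient_topology)
  let ?K = "{f \<in> isometries X. f x = x}"
  have "?q h \<in> ?q ` ?K" if h: "h \<in> isometries X" for h
  proof -
    have ih: "inv\<^bsub>?I\<^esub> h \<in> isometries X" using I.inv_closed[of h] h by simp
    \<comment> \<open>Chosen so that \<open>h l\<close> fixes \<open>x\<close>, while
      \<open>h l L = h L\<close>.\<close>
    then obtain l where l: "l \<in> L" "l x = (inv\<^bsub>?I\<^esub> h) x" using trans isometries_closed x by metis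
    have lI: "l \<in> isometries X" using l LI by auto
    define k where "k = h \<otimes>\<^bsub>?I\<^esub> l"
    have kI: "k \<in> isometries X" using I.m_closed[of h l] h lI by (simp add: k_def)
    have one: "\<one>\<^bsub>?I\<^esub> = (\<lambda>y\<in>?V. y)" by (simp add: isometry_group_def BijGroup_def)
    have "k x = h ((inv\<^bsub>?I\<^esub> h) x)" using x by (simp add: k_def isometries_mult h lI l(2) compose_eq)
    also have "\<dots> = (h \<otimes>\<^bsub>?I\<^esub> inv\<^bsub>?I\<^esub> h) x" using x by (simp add: isometries_mult h ih compose_eq)
    also have "\<dots> = x" using x I.r_inv[of h] h by (simp add: one)
    finally have "k \<in> ?K" using kI by simp
    moreover have "?q k = ?q h"
    proof -
      have "?q k = h <#\<^bsub>?I\<^esub> (l <#\<^bsub>?I\<^esub> L)"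
        using h lI LI by (simp add: k_def I.lcos_m_assoc)
      also have "l <#\<^bsub>?I\<^esub> L = L" using I.coset_join3[OF _ L l(1)] lI by simp
      finally show ?thesis .
    qed
    ultimately show ?thesis by blast
  qed
  then have "?q ` ?K = ?q ` isometries X" by auto
  also have "\<dots> = topspace (quotient_topology ?T ?q)"
    using q by (simp add: quotient_map_def topspace_pointwise_topology)
  finally have "?q ` ?K = topspace (quotient_topology ?T ?q)" .
  moreover have "compactin (quotient_topology ?T ?q) (?q ` ?K)"
    using compactin_stabilizer[OF x] quotient_imp_continuous_map[OF q] by (rule image_compactin)
  ultimately show "compact_space (quotient_topology ?T ?q)" by (simp add: compact_space_def)
qed

end

text \<open>Walks of each length correspond under \<open>f\<close> in both directions, so both
  distances are the \<open>LEAST\<close> of the same predicate.\<close>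

lemma isometriesI:
  assumes f: "f \<in> Bij (vertices X)" and adj: "adj X \<subseteq> vertices X \<times> vertices X"
    and iff: "\<And>x y. x \<in> vertices X \<Longrightarrow> y \<in> vertices X \<Longrightarrow> (f x, f y) \<in> adj X \<longleftrightarrow> (x, y) \<in> adj X"
  shows "f \<in> isometries X"
proof -
  let ?V = "vertices X"
  have inj: "inj_on f ?V" and im: "f ` ?V = ?V" using f by (auto simp: Bij_def bij_betw_def)
  have 1: "y \<in> ?V \<and> (f x, f y) \<in> adj X ^^ n" if "(x, y) \<in> adj X ^^ n" "x \<in> ?V" for x y n
    using that
  proof (induction n arbitrary: y)
    case (Suc n)
    then obtain z where z: "(x, z) \<in> adj X ^^ n" "(z, y) \<in> adj X" by auto
    then have "z \<in> ?V" "y \<in> ?V" using adj by auto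
    then show ?case using Suc.IH[OF z(1) Suc.prems(2)] z(2) iff by auto
  qed simp
  have 2: "\<exists>y \<in> ?V. z = f y \<and> (x, y) \<in> adj X ^^ n" if "(f x, z) \<in> adj X ^^ n" "x \<in> ?V" for x z n
    using that
  proof (induction n arbitrary: z)
    case (Suc n)
    then obtain w where w: "(f x, w) \<in> adj X ^^ n" "(w, z) \<in> adj X" by auto
    then obtain y where y: "y \<in> ?V" "w = f y" "(x, y) \<in> adj X ^^ n" using Suc by blast
    have "z \<in> ?V" using w adj by auto
    then obtain y' where y': "y' \<in> ?V" "z = f y'" using im by blast
    then have "(y, y') \<in> adj X" using iff w y by auto
    then show ?case using y y' by auto
  qed auto
  have "(f x, f y) \<in> adj X ^^ n \<longleftrightarrow> (x, y) \<in> adj X ^^ n" if "x \<in> ?V" "y \<in> ?V" for x y n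
    using that 1[of x y n] 2[of x "f y" n] inj by (metis inj_on_contraD)
  then show ?thesis using f by (simp add: isometries_def graph_dist_def)
qed


section \<open>Groups acting on two coset trees\<close>

context group
begin

lemma inv_mult_cancel_left: "x \<in> carrier G \<Longrightarrow> y \<in> carrier G \<Longrightarrow> inv x \<otimes> (x \<otimes> y) = y"
  by (simp add: m_assoc[symmetric])

lemma mult_inv_cancel_left: "x \<in> carrier G \<Longrightarrow> y \<in> carrier G \<Longrightarrow> x \<otimes> (inv x \<otimes> y) = y"
  by (simp add: m_assoc[symmetric])

definition conj_pow :: "'a \<Rightarrow> int \<Rightarrow> 'a \<Rightarrow> 'a" where
  "conj_pow t k x = t [^] k \<otimes> x \<otimes> t [^] (- k)"

context
  fixes t assumes t: "t \<in> carrier G"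
begin

lemma conj_pow_closed [simp]: "x \<in> carrier G \<Longrightarrow> conj_pow t k x \<in> carrier G"
  using t by (simp add: conj_pow_def)

lemma conj_pow_0 [simp]: "x \<in> carrier G \<Longrightarrow> conj_pow t 0 x = x"
  by (simp add: conj_pow_def)

lemma conj_pow_one [simp]: "conj_pow t k \<one> = \<one>"
  using t by (simp add: conj_pow_def flip: int_pow_mult)

lemma conj_pow_add: "x \<in> carrier G \<Longrightarrow> conj_pow t k (conj_pow t l x) = conj_pow t (k + l) x"
proof -
  assume x: "x \<in> carrier G"
  have "t [^] (- (k + l)) = t [^] (- l) \<otimes> t [^] (- k)"
    using t by (simp add: add.commute flip: int_pow_mult)
  then show ?thesis using t x by (simp add: conj_pow_def int_pow_mult m_assoc)
qed

lemma conj_pow_mult: "x \<in> carrier G \<Longrightarrow> y \<in> carrier G \<Longrightarrow> conj_pow t k (x \<otimes> y) = conj_pow t k x \<otimes> conj_pow t k y"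
  using t by (simp add: conj_pow_def m_assoc int_pow_neg inv_solve_left)

lemma conj_pow_inv: "x \<in> carrier G \<Longrightarrow> conj_pow t k (inv x) = inv (conj_pow t k x)"
  using t by (simp add: conj_pow_def inv_mult_group m_assoc int_pow_neg)

lemma conj_pow_cancel: "x \<in> carrier G \<Longrightarrow> y \<in> carrier G \<Longrightarrow> conj_pow t k x = conj_pow t k y \<longleftrightarrow> x = y"
  by (metis add.left_inverse conj_pow_0 conj_pow_add)

lemma conj_pow_eqI:
  assumes "x \<in> carrier G" "y \<in> carrier G" "t \<otimes> y = x \<otimes> t"
  shows "conj_pow t (-1) x = y"
  using t assms(1,2) by (simp add: conj_pow_def int_pow_neg int_pow_1 m_assoc flip: assms(3))
    (simp add: inv_mult_cancel_left)

text \<open>Lets the second tree reuse the results on the first, with \<open>inv t\<close> in place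
  of \<open>t\<close>.\<close>

lemma conj_pow_inverse_base: "conj_pow (inv t) k x = conj_pow t (- k) x"
  using t by (simp add: conj_pow_def int_pow_inv flip: int_pow_neg)

end

end

text \<open>The vertices are the cosets \<open>g A\<close>, and the parent of \<open>g A\<close> is
  \<open>g s A\<close>. The labelling \<open>c\<close> is kept abstract because the vertices must
  later be natural numbers. \<open>transversal\<close> makes \<open>D\<close> a set of
  representatives of \<open>A\<close> modulo \<open>s^-1 A s\<close>; \<open>exhaust\<close> says
  that the conjugates \<open>s^k A s^-k\<close> fill the elements of height 0, which yields common
  ancestors.\<close>

locale coset_tree = group G for G (structure) +
  fixes s :: 'a and A :: "'a set" and \<rho> :: "'a \<Rightarrow> int" and D :: "'a set" and c :: "'a \<Rightarrow> 'v"
  assumes s: "s \<in> carrier G" and A: "subgroup A G"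
    and height_mult: "x \<in> carrier G \<Longrightarrow> y \<in> carrier G \<Longrightarrow> \<rho> (x \<otimes> y) = \<rho> x + \<rho> y"
    and height_s: "\<rho> s = -1" and height_A: "a \<in> A \<Longrightarrow> \<rho> a = 0"
    and contract: "a \<in> A \<Longrightarrow> conj_pow s (-1) a \<in> A"
    and exhaust: "x \<in> carrier G \<Longrightarrow> \<rho> x = 0 \<Longrightarrow> \<exists>k::nat. conj_pow s (- int k) x \<in> A"
    and D: "D \<subseteq> A" "card D > 0"
    and transversal: "a \<in> A \<Longrightarrow> \<exists>!d. d \<in> D \<and> conj_pow s 1 (inv d \<otimes> a) \<in> A"
    and c: "g \<in> carrier G \<Longrightarrow> h \<in> carrier G \<Longrightarrow> c g = c h \<longleftrightarrow> inv g \<otimes> h \<in> A"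
begin

definition V where "V = c ` carrier G"

definition rep where "rep v = inv_into (carrier G) c v"

definition parent where "parent v = c (rep v \<otimes> s)"

definition height where "height v = \<rho> (rep v)"

lemma rep: "v \<in> V \<Longrightarrow> rep v \<in> carrier G \<and> c (rep v) = v"
  by (simp add: V_def rep_def inv_into_into f_inv_into_f)

lemma A_closed [simp]: "a \<in> A \<Longrightarrow> a \<in> carrier G"
  using subgroup.mem_carrier[OF A] .

lemma height_one: "\<rho> \<one> = 0"
  using height_mult[of \<one> \<one>] by simp

lemma height_inv: "x \<in> carrier G \<Longrightarrow> \<rho> (inv x) = - \<rho> x"
  using height_mult[of "inv x" x] height_one by simp

lemma c_mult_s:
  assumes g: "g \<in> carrier G" and h: "h \<in> carrier G"
  shows "c (g \<otimes> s) = c (h \<otimes> s) \<longleftrightarrow> conj_pow s (-1) (inv g \<otimes> h) \<in> A"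
proof -
  have "inv (g \<otimes> s) \<otimes> (h \<otimes> s) = conj_pow s (-1) (inv g \<otimes> h)"
    using g h s by (simp add: conj_pow_def inv_mult_group m_assoc int_pow_neg int_pow_1)
  then show ?thesis using c g h s by simp
qed

text \<open>Replacing \<open>g\<close> by \<open>g a\<close> multiplies \<open>g s\<close> on the
  right by \<open>s^-1 a s\<close>, which stays in \<open>A\<close> by \<open>contract\<close>; so
  the choice made in \<open>rep\<close> is harmless.\<close>

lemma parent_c: "g \<in> carrier G \<Longrightarrow> parent (c g) = c (g \<otimes> s)"
proof -
  assume g: "g \<in> carrier G"
  then have r: "rep (c g) \<in> carrier G" "c (rep (c g)) = c g" using rep by (auto simp: V_def)
  then have "inv (rep (c g)) \<otimes> g \<in> A" using c g by blast
  then show ?thesis using c_mult_s r g contract by (simp add: parent_def)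
qed

lemma height_c: "g \<in> carrier G \<Longrightarrow> height (c g) = \<rho> g"
proof -
  assume g: "g \<in> carrier G"
  then have r: "rep (c g) \<in> carrier G" "c (rep (c g)) = c g" using rep by (auto simp: V_def)
  then have "inv (rep (c g)) \<otimes> g \<in> A" using c g by blast
  then have "\<rho> (inv (rep (c g)) \<otimes> g) = 0" by (rule height_A)
  then show ?thesis using height_mult r g by (simp add: height_def height_inv)
qed

lemma parent_pow: "g \<in> carrier G \<Longrightarrow> (parent ^^ i) (c g) = c (g \<otimes> s [^] i)"
  by (induction i) (use s in \<open>simp_all add: parent_c m_assoc\<close>)

lemma height_pow: "\<rho> (s [^] (i::nat)) = - int i"
  by (induction i) (use s in \<open>simp_all add: height_one height_mult height_s\<close>)

sublocale tree: leveled_tree V parent height "card D"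
proof
  fix v assume v: "v \<in> V"
  then obtain g where g: "g \<in> carrier G" "v = c g" by (auto simp: V_def)
  show "parent v \<in> V" using rep[OF v] s by (simp add: parent_def V_def)
  show "height (parent v) = height v - 1"
    using g s by (simp add: parent_c height_c height_mult height_s)
  \<comment> \<open>Each child of \<open>g A\<close> is some \<open>g a s^-1 A\<close> with
    \<open>a\<close> in \<open>A\<close>, and only the class of \<open>a\<close> modulo
    \<open>s^-1 A s\<close> matters.\<close>
  let ?f = "\<lambda>d. c (g \<otimes> d \<otimes> inv s)"
  have key: "inv (g \<otimes> d \<otimes> inv s) \<otimes> (g \<otimes> a \<otimes> inv s) = conj_pow s 1 (inv d \<otimes> a)"
    if "d \<in> A" "a \<in> A" for d a
  proof -
    have "inv g \<otimes> (g \<otimes> (a \<otimes> inv s)) = a \<otimes> inv s"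
      using that g s by (simp add: m_assoc[symmetric])
    then have "inv (g \<otimes> d \<otimes> inv s) \<otimes> (g \<otimes> a \<otimes> inv s) = s \<otimes> inv d \<otimes> a \<otimes> inv s"
      using that g s by (simp add: inv_mult_group m_assoc)
    then show ?thesis using that g s by (simp add: conj_pow_def m_assoc int_pow_neg int_pow_1)
  qed
  have "{w \<in> V. parent w = v} = ?f ` D"
  proof (intro equalityI subsetI)
    fix w assume "w \<in> {w \<in> V. parent w = v}"
    then obtain h where h: "h \<in> carrier G" "w = c h" "c (h \<otimes> s) = c g"
      using parent_c g by (auto simp: V_def)
    define a where "a = inv g \<otimes> (h \<otimes> s)"
    have a: "a \<in> A" using h g s c[of g "h \<otimes> s"] by (simp add: a_def)
    have heq: "h = g \<otimes> a \<otimes> inv s" using h g s by (simp add: a_def m_assoc[symmetric]) (simp add: m_assoc)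
    obtain d where d: "d \<in> D" "conj_pow s 1 (inv d \<otimes> a) \<in> A" using transversal[OF a] by blast
    then have "c (g \<otimes> d \<otimes> inv s) = c h" using key[of d a] a D(1) h g s c by (simp add: heq subset_iff)
    then show "w \<in> ?f ` D" using d h by force
  next
    fix w assume "w \<in> ?f ` D"
    then obtain d where d: "d \<in> D" "w = ?f d" by blast
    have "parent w = c (g \<otimes> d)" using d D(1) g s by (simp add: parent_c m_assoc subset_iff)
    also have "\<dots> = v" using d D(1) g c[of g "g \<otimes> d"] by (simp add: m_assoc[symmetric] subset_iff)
    finally show "w \<in> {w \<in> V. parent w = v}" using d D(1) g s by (auto simp: V_def subset_iff)
  qed
  moreover have "inj_on ?f D"
  proof (rule inj_onI)
    fix d e assume de: "d \<in> D" "e \<in> D" "?f d = ?f e"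
    then have A': "d \<in> A" "e \<in> A" using D by auto
    then have "conj_pow s 1 (inv d \<otimes> e) \<in> A" using key[of d e] de(3) g s c by simp
    moreover have "conj_pow s 1 (inv e \<otimes> e) \<in> A" using A' s subgroup.one_closed[OF A] by simp
    ultimately show "d = e" using transversal[OF A'(2)] de by blast
  qed
  ultimately show "card {w \<in> V. parent w = v} = card D" by (simp add: card_image)
next
  show "card D > 0" by (rule D)
next
  fix v w assume "v \<in> V" "w \<in> V"
  then obtain g h where gh: "g \<in> carrier G" "h \<in> carrier G" "v = c g" "w = c h" by (auto simp: V_def)
  \<comment> \<open>Climb first from the higher vertex to the level of the lower one, so one of
    \<open>i\<close>, \<open>j\<close> is 0; \<open>exhaust\<close> gives the \<open>k\<close>
    further steps to a common ancestor.\<close>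
  define i j where "i = nat (max 0 (\<rho> g - \<rho> h))" and "j = nat (max 0 (\<rho> h - \<rho> g))"
  define x where "x = inv (g \<otimes> s [^] i) \<otimes> (h \<otimes> s [^] j)"
  have x: "x \<in> carrier G" using gh s by (simp add: x_def)
  have "\<rho> x = 0" using gh s
    by (simp add: x_def height_mult height_inv height_pow) (simp add: i_def j_def)
  then obtain k where k: "conj_pow s (- int k) x \<in> A" using exhaust x by blast
  have "conj_pow s (- int k) x = inv (g \<otimes> s [^] (i + k)) \<otimes> (h \<otimes> s [^] (j + k))"
    using gh s by (simp add: conj_pow_def x_def inv_mult_group m_assoc int_pow_neg int_pow_int
        nat_pow_mult[symmetric] int_pow_0)
  then have "c (g \<otimes> s [^] (i + k)) = c (h \<otimes> s [^] (j + k))" using k c gh s by simp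
  then have "(parent ^^ (i + k)) v = (parent ^^ (j + k)) w"
    using gh parent_pow by simp
  then show "\<exists>i j. (parent ^^ i) v = (parent ^^ j) w" by blast
next
  show "\<exists>v \<in> V. height v = 0"
    by (rule bexI[of _ "c \<one>"]) (simp_all add: height_c height_one V_def)
qed

end


text \<open>Left cosets \<open>g A\<close> and \<open>g B\<close> are the vertices of the two trees, with parents \<open>g t A\<close> and
  \<open>g t\<^sup>-\<^sup>1 B\<close> and heights \<open>- \<pi> g\<close> and \<open>\<pi> g\<close>.  Since \<open>A B\<close> is the kernel of \<open>\<pi>\<close> and \<open>A\<close>, \<open>B\<close> meet
  trivially, cosets of opposite heights share exactly one element, so the vertices of the
  horocyclic product correspond to the group elements.\<close>

locale horocyclic_group = group G for G (structure) +
  fixes t :: 'a and A B :: "'a set" and \<pi> :: "'a \<Rightarrow> int"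
  assumes t: "t \<in> carrier G" and A: "subgroup A G" and B: "subgroup B G"
    and countable: "countable (carrier G)"
    and \<pi>_mult: "x \<in> carrier G \<Longrightarrow> y \<in> carrier G \<Longrightarrow> \<pi> (x \<otimes> y) = \<pi> x + \<pi> y"
    and \<pi>_t: "\<pi> t = 1"
    and \<pi>_A: "a \<in> A \<Longrightarrow> \<pi> a = 0" and \<pi>_B: "b \<in> B \<Longrightarrow> \<pi> b = 0"
    and contract_A: "a \<in> A \<Longrightarrow> conj_pow t (-1) a \<in> A"
    and contract_B: "b \<in> B \<Longrightarrow> conj_pow t 1 b \<in> B"
    and exhaust_A: "x \<in> carrier G \<Longrightarrow> \<pi> x = 0 \<Longrightarrow> \<exists>k::nat. conj_pow t (- int k) x \<in> A"
    and exhaust_B: "x \<in> carrier G \<Longrightarrow> \<pi> x = 0 \<Longrightarrow> \<exists>k::nat. conj_pow t (int k) x \<in> B"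
    and disjoint: "A \<inter> B = {\<one>}"
    and decompose: "x \<in> carrier G \<Longrightarrow> \<pi> x = 0 \<Longrightarrow> \<exists>a \<in> A. \<exists>b \<in> B. x = a \<otimes> b"
    and card_D: "card {d \<in> A. conj_pow t 1 d \<in> B} \<ge> 2"
begin

text \<open>The intersection of \<open>A\<close> with \<open>t^-1 B t\<close>. It is a transversal
  of \<open>A\<close> modulo \<open>t^-1 A t\<close>, and its conjugate \<open>t D t^-1\<close>
  plays the same role for \<open>B\<close>, so both trees have the same branching number.\<close>

definition D where "D = {d \<in> A. conj_pow t 1 d \<in> B}"

lemma A_closed [simp]: "a \<in> A \<Longrightarrow> a \<in> carrier G"
  using subgroup.mem_carrier[OF A] .

lemma B_closed [simp]: "a \<in> B \<Longrightarrow> a \<in> carrier G"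
  using subgroup.mem_carrier[OF B] .

lemma \<pi>_one: "\<pi> \<one> = 0"
  using \<pi>_mult[of \<one> \<one>] by simp

lemma \<pi>_inv: "x \<in> carrier G \<Longrightarrow> \<pi> (inv x) = - \<pi> x"
  using \<pi>_mult[of "inv x" x] \<pi>_one by simp

lemma \<pi>_conj: "x \<in> carrier G \<Longrightarrow> \<pi> (conj_pow t k x) = \<pi> x"
  using t by (simp add: conj_pow_def \<pi>_mult \<pi>_inv int_pow_neg)

lemma decompose': "x \<in> carrier G \<Longrightarrow> \<pi> x = 0 \<Longrightarrow> \<exists>a \<in> A. \<exists>b \<in> B. x = b \<otimes> a"
proof -
  assume x: "x \<in> carrier G" "\<pi> x = 0"
  then obtain a b where ab: "a \<in> A" "b \<in> B" "inv x = a \<otimes> b"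
    using decompose[of "inv x"] by (auto simp: \<pi>_inv)
  then have "x = inv b \<otimes> inv a" using x by (metis A_closed B_closed inv_inv inv_mult_group)
  then show ?thesis using ab subgroup.m_inv_closed[OF A] subgroup.m_inv_closed[OF B] by blast
qed

lemma A_eq_B: "a \<in> A \<Longrightarrow> a \<in> B \<Longrightarrow> a = \<one>"
  using disjoint by blast

lemma D_unique:
  assumes "d \<in> D" "e \<in> D" "conj_pow t 1 (inv d \<otimes> e) \<in> A"
  shows "d = e"
proof -
  have de: "d \<in> A" "e \<in> A" "conj_pow t 1 d \<in> B" "conj_pow t 1 e \<in> B"
    using assms by (auto simp: D_def)
  have "conj_pow t 1 (inv d \<otimes> e) = inv (conj_pow t 1 d) \<otimes> conj_pow t 1 e"
    using de t by (simp add: conj_pow_mult conj_pow_inv)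
  also have "\<dots> \<in> B" using de B by (simp add: subgroup.m_closed subgroup.m_inv_closed)
  finally have "conj_pow t 1 (inv d \<otimes> e) = conj_pow t 1 \<one>"
    using A_eq_B[OF assms(3)] conj_pow_one[OF t, of 1] by (simp only:)
  then have "inv d \<otimes> e = \<one>" using de t by (subst (asm) conj_pow_cancel) auto
  then show ?thesis using de by (metis A_closed inv_closed inv_equality inv_inv)
qed

text \<open>For existence, factor \<open>t a t^-1 = y x\<close> with \<open>y\<close> in
  \<open>B\<close> and \<open>x\<close> in \<open>A\<close>. Then \<open>d = t^-1 y t\<close>
  satisfies \<open>t d t^-1 = y\<close>, and it lies in \<open>A\<close> because \<open>a\<close>
  and \<open>t^-1 x t\<close> do.\<close>

lemma transversal_A:
  assumes a: "a \<in> A"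
  shows "\<exists>!d. d \<in> D \<and> conj_pow t 1 (inv d \<otimes> a) \<in> A"
proof -
  obtain x y where xy: "x \<in> A" "y \<in> B" "conj_pow t 1 a = y \<otimes> x"
    using decompose'[of "conj_pow t 1 a"] a t \<pi>_A \<pi>_conj by auto
  define d where "d = conj_pow t (-1) y"
  have dc: "d \<in> carrier G" using xy t by (simp add: d_def)
  have yd: "conj_pow t 1 d = y" using xy t by (simp add: d_def conj_pow_add)
  have "conj_pow t 1 (inv d \<otimes> a) = inv y \<otimes> (y \<otimes> x)"
    using dc a t yd xy by (simp add: conj_pow_mult conj_pow_inv)
  also have "\<dots> = x" using xy by (simp add: m_assoc[symmetric])
  finally have dx: "conj_pow t 1 (inv d \<otimes> a) = x" .
  then have "inv d \<otimes> a = conj_pow t (-1) x"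
    using dc a t conj_pow_add[OF t, of "inv d \<otimes> a" "-1" 1] by simp
  then have "inv d \<otimes> a \<in> A" using contract_A xy by simp
  then have "a \<otimes> inv (inv d \<otimes> a) \<in> A"
    using a A by (metis subgroup.m_closed subgroup.m_inv_closed)
  moreover have "a \<otimes> inv (inv d \<otimes> a) = d"
    using a dc by (simp add: inv_mult_group m_assoc[symmetric])
  ultimately have "d \<in> D" using yd xy by (simp add: D_def)
  then have ex: "d \<in> D \<and> conj_pow t 1 (inv d \<otimes> a) \<in> A" using dx xy by simp
  show ?thesis
  proof (rule ex1I[of _ d], rule ex)
    fix e assume e: "e \<in> D \<and> conj_pow t 1 (inv e \<otimes> a) \<in> A"
    then have ec: "e \<in> carrier G" by (simp add: D_def)
    have "conj_pow t 1 (inv e \<otimes> a) \<otimes> inv (conj_pow t 1 (inv d \<otimes> a)) \<in> A"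
      using e ex A by (simp add: subgroup.m_closed subgroup.m_inv_closed)
    also have "conj_pow t 1 (inv e \<otimes> a) \<otimes> inv (conj_pow t 1 (inv d \<otimes> a)) = conj_pow t 1 (inv e \<otimes> d)"
    proof -
      have "a \<otimes> (inv a \<otimes> d) = d" using a dc by (simp add: m_assoc[symmetric])
      then have "(inv e \<otimes> a) \<otimes> inv (inv d \<otimes> a) = inv e \<otimes> d"
        using a dc ec by (simp add: inv_mult_group m_assoc)
      then show ?thesis using a dc ec t by (simp flip: conj_pow_inv conj_pow_mult)
    qed
    finally show "e = d" using D_unique e ex by blast
  qed
qed


text \<open>The axioms are symmetric in the two subgroups, so everything proved about the cosets of
  \<open>A\<close> transfers to those of \<open>B\<close>.\<close>

lemma swap: "horocyclic_group G (inv t) B A (\<lambda>x. - \<pi> x)"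
proof (intro horocyclic_group.intro group_axioms horocyclic_group_axioms.intro)
  have "bij_betw (conj_pow t 1) {d \<in> A. conj_pow t 1 d \<in> B} {d \<in> B. conj_pow (inv t) 1 d \<in> A}"
    by (rule bij_betw_byWitness[where f' = "conj_pow t (-1)"])
      (use t in \<open>auto simp: conj_pow_add conj_pow_inverse_base\<close>)
  from bij_betw_same_card[OF this] show "2 \<le> card {d \<in> B. conj_pow (inv t) 1 d \<in> A}"
    using card_D by simp
  show "\<exists>a \<in> B. \<exists>b \<in> A. x = a \<otimes> b" if "x \<in> carrier G" "- \<pi> x = 0" for x
    using decompose'[of x] that by auto
  show "\<exists>k. conj_pow (inv t) (- int k) x \<in> B" if "x \<in> carrier G" "- \<pi> x = 0" for x
    using exhaust_B[of x] that t by (auto simp: conj_pow_inverse_base)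
  show "\<exists>k. conj_pow (inv t) (int k) x \<in> A" if "x \<in> carrier G" "- \<pi> x = 0" for x
    using exhaust_A[of x] that t by (auto simp: conj_pow_inverse_base)
  show "B \<inter> A = {\<one>}" using disjoint by blast
  show "conj_pow (inv t) (-1) b \<in> B" if "b \<in> B" for b
    using contract_B[OF that] t by (simp add: conj_pow_inverse_base)
  show "conj_pow (inv t) 1 a \<in> A" if "a \<in> A" for a
    using contract_A[OF that] t by (simp add: conj_pow_inverse_base)
qed (simp_all add: t A B countable \<pi>_mult \<pi>_t \<pi>_A \<pi>_B \<pi>_inv)

text \<open>\<open>diestel_leader_graph\<close> asks for trees on natural numbers, so cosets are
  replaced by their indices in an enumeration; countability of the group makes this
  injective.\<close>

definition c\<^sub>A where "c\<^sub>A g = to_nat_on ((\<lambda>g. g <#\<^bsub>G\<^esub> A) ` carrier G) (g <#\<^bsub>G\<^esub> A)"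

lemma c\<^sub>A_eq_iff:
  assumes "g \<in> carrier G" "h \<in> carrier G"
  shows "c\<^sub>A g = c\<^sub>A h \<longleftrightarrow> inv g \<otimes> h \<in> A"
proof -
  have "countable ((\<lambda>g. g <#\<^bsub>G\<^esub> A) ` carrier G)" using countable by simp
  then have "c\<^sub>A g = c\<^sub>A h \<longleftrightarrow> g <#\<^bsub>G\<^esub> A = h <#\<^bsub>G\<^esub> A" using assms by (simp add: c\<^sub>A_def)
  also have "\<dots> \<longleftrightarrow> inv g \<otimes> h \<in> A"
  proof
    assume "g <#\<^bsub>G\<^esub> A = h <#\<^bsub>G\<^esub> A"
    then have "h \<in> g <#\<^bsub>G\<^esub> A" using assms subgroup.one_closed[OF A] by (force simp: l_coset_def)
    then show "inv g \<otimes> h \<in> A" using assms by (auto simp: l_coset_def m_assoc[symmetric])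
  next
    assume "inv g \<otimes> h \<in> A"
    then have "g \<otimes> (inv g \<otimes> h) \<in> g <#\<^bsub>G\<^esub> A" by (auto simp: l_coset_def)
    then have "h \<in> g <#\<^bsub>G\<^esub> A" using assms by (simp add: m_assoc[symmetric])
    then show "g <#\<^bsub>G\<^esub> A = h <#\<^bsub>G\<^esub> A" using assms A by (metis l_repr_independence)
  qed
  finally show ?thesis .
qed

lemma coset_tree: "coset_tree G t A (\<lambda>x. - \<pi> x) D c\<^sub>A"
proof (intro coset_tree.intro group_axioms coset_tree_axioms.intro)
  show "card D > 0" using card_D by (simp add: D_def)
  show "D \<subseteq> A" by (auto simp: D_def)
  show "\<exists>!d. d \<in> D \<and> conj_pow t 1 (inv d \<otimes> a) \<in> A" if "a \<in> A" for a
    using that by (rule transversal_A)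
  show "c\<^sub>A g = c\<^sub>A h \<longleftrightarrow> inv g \<otimes> h \<in> A" if "g \<in> carrier G" "h \<in> carrier G" for g h
    using that by (rule c\<^sub>A_eq_iff)
  show "\<exists>k. conj_pow t (- int k) x \<in> A" if "x \<in> carrier G" "- \<pi> x = 0" for x
    using exhaust_A[of x] that by simp
qed (simp_all add: t A \<pi>_mult \<pi>_t \<pi>_A contract_A)


lemma one_in_D: "\<one> \<in> D"
  using A B t subgroup.one_closed by (auto simp: D_def)

lemma contract_B_pow: "b \<in> B \<Longrightarrow> conj_pow t (int k) b \<in> B"
proof (induction k)
  case (Suc k)
  have "conj_pow t (int (Suc k)) b = conj_pow t 1 (conj_pow t (int k) b)"
    using Suc.prems t by (simp add: conj_pow_add)
  then show ?case using contract_B Suc by simp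
qed (simp add: t)

lemma subgroup_conj_pow:
  assumes "subgroup K G" "t \<in> K" "x \<in> K"
  shows "conj_pow t k x \<in> K"
  using assms subgroup_int_pow_closed by (auto simp: conj_pow_def intro!: subgroup.m_closed)

text \<open>The source of connectedness of the horocyclic product. Elements of \<open>A\<close> are
  products of conjugates of elements of \<open>D\<close>, elements of \<open>B\<close> are conjugate
  into \<open>A\<close> by powers of \<open>t\<close>, and every \<open>x\<close> is
  \<open>a b\<close> times a power of \<open>t\<close>.\<close>

lemma generated:
  assumes K: "subgroup K G" and tK: "t \<in> K" and DK: "D \<subseteq> K"
  shows "K = carrier G"
proof -
  have AB: "a \<in> K" if "a \<in> A" "conj_pow t (int k) a \<in> B" for a k
    using that
  proof (induction k arbitrary: a)
    case 0
    then show ?case using A_eq_B t subgroup.one_closed[OF K] by auto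
  next
    case (Suc k)
    obtain d where d: "d \<in> D" "conj_pow t 1 (inv d \<otimes> a) \<in> A"
      using transversal_A[OF Suc.prems(1)] by blast
    have dc: "d \<in> carrier G" "conj_pow t 1 d \<in> B" and ac: "a \<in> carrier G"
      using d Suc.prems by (simp_all add: D_def)
    have dB: "conj_pow t (1 + int k) d \<in> B"
      using contract_B_pow[OF dc(2), of k] dc t by (simp add: conj_pow_add add.commute)
    \<comment> \<open>Once the factor \<open>d\<close> is split off, the conjugate \<open>a'\<close>
      is in \<open>A\<close> and needs one conjugation less to reach \<open>B\<close>.\<close>
    define a' where "a' = conj_pow t 1 (inv d \<otimes> a)"
    have "conj_pow t (int k) a' = inv (conj_pow t (1 + int k) d) \<otimes> conj_pow t (1 + int k) a"
      using dc ac t by (simp add: a'_def conj_pow_add conj_pow_mult conj_pow_inv add.commute)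
    also have "\<dots> \<in> B" using dB Suc.prems B by (simp add: subgroup.m_closed subgroup.m_inv_closed)
    finally have "a' \<in> K" using Suc.IH d by (simp add: a'_def)
    then have "conj_pow t (-1) a' \<in> K" using subgroup_conj_pow[OF K tK] by blast
    then have "inv d \<otimes> a \<in> K" using dc ac t by (simp add: a'_def conj_pow_add)
    then have "d \<otimes> (inv d \<otimes> a) \<in> K" using d DK K by (auto intro: subgroup.m_closed)
    then show ?case using dc ac by (simp add: m_assoc[symmetric])
  qed
  have AK: "a \<in> K" if "a \<in> A" for a
    using AB[OF that] exhaust_B[of a] that \<pi>_A by auto
  have BK: "b \<in> K" if b: "b \<in> B" for b
  proof -
    obtain k where "conj_pow t (- int k) b \<in> A" using exhaust_A[of b] b \<pi>_B by auto
    then have "conj_pow t (int k) (conj_pow t (- int k) b) \<in> K"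
      using AK subgroup_conj_pow[OF K tK] by blast
    then show ?thesis using b t by (simp add: conj_pow_add)
  qed
  have \<pi>_pow: "\<pi> (t [^] (k::int)) = k" for k
  proof -
    have nat: "\<pi> (t [^] (n::nat)) = int n" for n
      by (induction n) (use t in \<open>simp_all add: \<pi>_one \<pi>_mult \<pi>_t\<close>)
    show ?thesis
      by (cases k rule: int_cases2) (use t nat in \<open>simp_all add: int_pow_int int_pow_neg_int \<pi>_inv\<close>)
  qed
  have "x \<in> K" if x: "x \<in> carrier G" for x
  proof -
    obtain a b where ab: "a \<in> A" "b \<in> B" "x \<otimes> t [^] (- \<pi> x) = a \<otimes> b"
      using decompose[of "x \<otimes> t [^] (- \<pi> x)"] x t by (auto simp: \<pi>_mult \<pi>_pow)
    have "x = (x \<otimes> t [^] (- \<pi> x)) \<otimes> t [^] \<pi> x"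
      using x t by (simp add: m_assoc flip: int_pow_mult)
    also have "\<dots> \<in> K" unfolding ab
      using AK BK ab K tK by (auto intro!: subgroup.m_closed subgroup_int_pow_closed)
    finally show ?thesis .
  qed
  then show ?thesis using subgroup.subset[OF K] by blast
qed

end

section \<open>The horocyclic product of the two coset trees\<close>

context horocyclic_group
begin

interpretation S: horocyclic_group G "inv t" B A "\<lambda>x. - \<pi> x" by (rule swap)
interpretation TA: coset_tree G t A "\<lambda>x. - \<pi> x" D c\<^sub>A by (rule coset_tree)
interpretation TB: coset_tree G "inv t" B \<pi> S.D S.c\<^sub>A using S.coset_tree by simp

definition DL where
  "DL = horocyclic_product (parent_graph TA.V TA.parent) TA.height (parent_graph TB.V TB.parent) TB.height"

definition \<theta> where "\<theta> g = (c\<^sub>A g, S.c\<^sub>A g)"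

lemma \<theta>_inj: "inj_on \<theta> (carrier G)"
proof (rule inj_onI)
  fix g h assume gh: "g \<in> carrier G" "h \<in> carrier G" "\<theta> g = \<theta> h"
  then have "inv g \<otimes> h \<in> A" "inv g \<otimes> h \<in> B"
    using c\<^sub>A_eq_iff S.c\<^sub>A_eq_iff by (simp_all add: \<theta>_def)
  then have "inv g \<otimes> h = \<one>" using A_eq_B by blast
  then show "g = h" using gh by (metis inv_closed inv_equality inv_inv)
qed

text \<open>A pair \<open>(g A, h B)\<close> of opposite heights has
  \<open>\<pi> g = \<pi> h\<close>. Factoring \<open>g^-1 h = a b\<close>, the element
  \<open>g a\<close> lies in \<open>g A\<close>, and \<open>h = (g a) b\<close> shows
  \<open>g a B = h B\<close>.\<close>

lemma vertices_DL: "vertices DL = \<theta> ` carrier G"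
proof (intro equalityI subsetI)
  fix v assume "v \<in> vertices DL"
  then obtain x y where xy: "v = (x, y)" "x \<in> TA.V" "y \<in> TB.V" "TA.height x + TB.height y = 0"
    by (auto simp: DL_def horocyclic_product_def)
  then obtain g h where gh: "g \<in> carrier G" "h \<in> carrier G" "v = (c\<^sub>A g, S.c\<^sub>A h)" "- \<pi> g + \<pi> h = 0"
    by (auto simp: TA.V_def TB.V_def TA.height_c TB.height_c)
  then obtain a b where ab: "a \<in> A" "b \<in> B" "inv g \<otimes> h = a \<otimes> b"
    using decompose[of "inv g \<otimes> h"] by (auto simp: \<pi>_mult \<pi>_inv)
  have "h = g \<otimes> (inv g \<otimes> h)" using gh by (simp add: m_assoc[symmetric])
  then have h: "h = (g \<otimes> a) \<otimes> b" unfolding ab using gh ab by (simp add: m_assoc)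
  have "c\<^sub>A g = c\<^sub>A (g \<otimes> a)" using c\<^sub>A_eq_iff gh ab by (simp add: m_assoc[symmetric])
  moreover have "S.c\<^sub>A (g \<otimes> a) = S.c\<^sub>A h"
    using S.c\<^sub>A_eq_iff[of "g \<otimes> a" h] gh ab by (simp add: h inv_mult_group m_assoc inv_mult_cancel_left)
  ultimately show "v \<in> \<theta> ` carrier G" using gh ab by (auto simp: \<theta>_def intro!: image_eqI[of _ _ "g \<otimes> a"])
next
  fix v assume "v \<in> \<theta> ` carrier G"
  then obtain g where g: "g \<in> carrier G" "v = (c\<^sub>A g, S.c\<^sub>A g)" by (auto simp: \<theta>_def)
  then have "c\<^sub>A g \<in> TA.V" "S.c\<^sub>A g \<in> TB.V" "TA.height (c\<^sub>A g) + TB.height (S.c\<^sub>A g) = 0"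
    by (simp_all add: TA.V_def TB.V_def TA.height_c TB.height_c)
  then show "v \<in> vertices DL" using g by (simp add: DL_def horocyclic_product_def)
qed

lemma adj_DL:
  assumes "g \<in> carrier G" "h \<in> carrier G"
  shows "(\<theta> g, \<theta> h) \<in> adj DL \<longleftrightarrow>
    (c\<^sub>A h = c\<^sub>A (g \<otimes> t) \<or> c\<^sub>A g = c\<^sub>A (h \<otimes> t)) \<and>
    (S.c\<^sub>A h = S.c\<^sub>A (g \<otimes> inv t) \<or> S.c\<^sub>A g = S.c\<^sub>A (h \<otimes> inv t))"
proof -
  have "c\<^sub>A x \<in> TA.V" "S.c\<^sub>A x \<in> TB.V" "TA.height (c\<^sub>A x) + TB.height (S.c\<^sub>A x) = 0"
    if "x \<in> carrier G" for x
    using that by (simp_all add: TA.V_def TB.V_def TA.height_c TB.height_c)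
  then show ?thesis using assms
    by (simp add: DL_def horocyclic_product_def \<theta>_def TA.tree.adj_iff TB.tree.adj_iff TA.parent_c TB.parent_c)
qed

lemma adj_DL_vertices: "adj DL \<subseteq> vertices DL \<times> vertices DL"
  by (auto simp: DL_def horocyclic_product_def)

lemma sym_adj_DL: "sym (adj DL)"
  using TA.tree.sym_adj TB.tree.sym_adj by (auto simp: DL_def horocyclic_product_def sym_def)

lemma locally_finite_DL: "finite {w. (v, w) \<in> adj DL}"
proof -
  have 1: "finite {w. (v, w) \<in> adj TA.tree.X}" for v
    by (cases "v \<in> TA.V") (use TA.tree.regular in \<open>auto simp: regular_tree_def TA.tree.adj_iff intro: card_ge_0_finite\<close>)
  have 2: "finite {w. (v, w) \<in> adj TB.tree.X}" for v
    by (cases "v \<in> TB.V") (use TB.tree.regular in \<open>auto simp: regular_tree_def TB.tree.adj_iff intro: card_ge_0_finite\<close>)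
  have "{w. (v, w) \<in> adj DL} \<subseteq> {w. (fst v, w) \<in> adj TA.tree.X} \<times> {w. (snd v, w) \<in> adj TB.tree.X}"
    by (auto simp: DL_def horocyclic_product_def)
  then show ?thesis using 1 2 by (meson finite_SigmaI finite_subset)
qed

text \<open>Right multiplication by \<open>t d\<close> with \<open>d\<close> in \<open>D\<close>
  moves along an edge. Taking \<open>d = \<one>\<close> gives \<open>t\<close>, hence all of
  \<open>D\<close>, and \<open>generated\<close> finishes.\<close>

lemma connected_DL: "connected_graph DL"
proof -
  \<comment> \<open>Quantifying over all starting points \<open>g\<close> is what makes
    \<open>K\<close> closed under products and inverses.\<close>
  define K where "K = {x \<in> carrier G. \<forall>g \<in> carrier G. (\<theta> g, \<theta> (g \<otimes> x)) \<in> (adj DL)\<^sup>*}"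
  have K: "subgroup K G"
  proof (rule subgroupI)
    show "K \<subseteq> carrier G" by (auto simp: K_def)
    have "\<one> \<in> K" by (simp add: K_def)
    then show "K \<noteq> {}" by blast
    fix x assume x: "x \<in> K"
    show "inv x \<in> K" unfolding K_def
    proof (intro CollectI conjI ballI)
      fix g assume g: "g \<in> carrier G"
      then have "(\<theta> (g \<otimes> inv x), \<theta> (g \<otimes> inv x \<otimes> x)) \<in> (adj DL)\<^sup>*" using x by (simp add: K_def)
      then have "(\<theta> (g \<otimes> inv x), \<theta> g) \<in> (adj DL)\<^sup>*" using x g by (simp add: K_def m_assoc)
      then show "(\<theta> g, \<theta> (g \<otimes> inv x)) \<in> (adj DL)\<^sup>*" using sym_rtrancl[OF sym_adj_DL] by (meson symD)
    qed (use x in \<open>simp add: K_def\<close>)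
    fix y assume y: "y \<in> K"
    show "x \<otimes> y \<in> K" unfolding K_def
    proof (intro CollectI conjI ballI)
      fix g assume g: "g \<in> carrier G"
      have "(\<theta> g, \<theta> (g \<otimes> x)) \<in> (adj DL)\<^sup>*" "(\<theta> (g \<otimes> x), \<theta> (g \<otimes> x \<otimes> y)) \<in> (adj DL)\<^sup>*"
        using x y g by (simp_all add: K_def)
      then have "(\<theta> g, \<theta> (g \<otimes> x \<otimes> y)) \<in> (adj DL)\<^sup>*" by (rule rtrancl_trans)
      then show "(\<theta> g, \<theta> (g \<otimes> (x \<otimes> y))) \<in> (adj DL)\<^sup>*" using x y g by (simp add: K_def m_assoc)
    qed (use x y in \<open>simp add: K_def\<close>)
  qed
  \<comment> \<open>In the first tree \<open>g t d A = g t A\<close> is the parent of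
    \<open>g A\<close>; in the second, \<open>t d t^-1\<close> lies in \<open>B\<close>, so
    \<open>g B\<close> is the parent of \<open>g t d B\<close>.\<close>
  have td: "t \<otimes> d \<in> K" if d: "d \<in> D" for d
  proof -
    have dA: "d \<in> A" "conj_pow t 1 d \<in> B" using d by (simp_all add: D_def)
    have "(\<theta> g, \<theta> (g \<otimes> (t \<otimes> d))) \<in> adj DL" if g: "g \<in> carrier G" for g
    proof -
      have "inv (g \<otimes> t) \<otimes> (g \<otimes> (t \<otimes> d)) = d"
        using g dA t by (simp add: inv_mult_group m_assoc inv_mult_cancel_left)
      then have 1: "c\<^sub>A (g \<otimes> (t \<otimes> d)) = c\<^sub>A (g \<otimes> t)"
        using c\<^sub>A_eq_iff[of "g \<otimes> t" "g \<otimes> (t \<otimes> d)"] g dA t by simp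
      have "inv g \<otimes> (g \<otimes> (t \<otimes> d) \<otimes> inv t) = conj_pow t 1 d"
        using g dA t by (simp add: conj_pow_def int_pow_neg int_pow_1 m_assoc[symmetric])
      then have "S.c\<^sub>A g = S.c\<^sub>A (g \<otimes> (t \<otimes> d) \<otimes> inv t)"
        using S.c\<^sub>A_eq_iff g dA t by simp
      then show ?thesis using 1 g dA t by (simp add: adj_DL)
    qed
    then show ?thesis using dA t by (auto simp: K_def)
  qed
  have tK: "t \<in> K" using td[OF one_in_D] t by simp
  moreover have "D \<subseteq> K"
  proof
    fix d assume d: "d \<in> D"
    have "inv t \<otimes> (t \<otimes> d) \<in> K"
      using td[OF d] tK K by (simp add: subgroup.m_closed subgroup.m_inv_closed)
    then show "d \<in> K" using d t by (simp add: D_def m_assoc[symmetric])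
  qed
  ultimately have "K = carrier G" using generated K by blast
  then have K': "(\<theta> g, \<theta> (g \<otimes> x)) \<in> (adj DL)\<^sup>*" if "g \<in> carrier G" "x \<in> carrier G" for g x
    using that unfolding K_def by blast
  have "(\<theta> g, \<theta> h) \<in> (adj DL)\<^sup>*" if "g \<in> carrier G" "h \<in> carrier G" for g h
    using K'[of g "inv g \<otimes> h"] that by (simp add: m_assoc[symmetric])
  then show ?thesis by (auto simp: connected_graph_def vertices_DL)
qed

lemma diestel_leader_DL: "diestel_leader_graph (card D) (card S.D) DL"
  using card_D S.card_D TA.tree.regular TA.tree.busemann TB.tree.regular TB.tree.busemann
  unfolding diestel_leader_graph_def DL_def D_def[symmetric] S.D_def[symmetric] by blast

text \<open>Left translation carried over to vertices by \<open>\<theta>\<close>; it is restricted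
  to the vertices because \<open>Bij\<close> requires extensional functions.\<close>

definition \<sigma> where
  "\<sigma> x = (\<lambda>v \<in> vertices DL. \<theta> (x \<otimes> inv_into (carrier G) \<theta> v))"

lemma \<sigma>_\<theta>: "g \<in> carrier G \<Longrightarrow> \<sigma> x (\<theta> g) = \<theta> (x \<otimes> g)"
  by (simp add: \<sigma>_def vertices_DL \<theta>_inj)

text \<open>Equality of cosets depends only on \<open>inv g \<otimes> h\<close>, which left
  translation leaves unchanged, while parents are formed by right multiplication.\<close>

lemma \<sigma>_isometry:
  assumes x: "x \<in> carrier G"
  shows "\<sigma> x \<in> isometries DL"
proof (rule isometriesI)
  have "bij_betw (\<sigma> x) (vertices DL) (vertices DL)"
  proof (rule bij_betw_byWitness[where f' = "\<sigma> (inv x)"])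
    show "\<forall>v\<in>vertices DL. \<sigma> (inv x) (\<sigma> x v) = v" "\<forall>v\<in>vertices DL. \<sigma> x (\<sigma> (inv x) v) = v"
      using x by (auto simp: vertices_DL \<sigma>_\<theta> m_assoc[symmetric])
    show "\<sigma> x ` vertices DL \<subseteq> vertices DL" "\<sigma> (inv x) ` vertices DL \<subseteq> vertices DL"
      using x by (auto simp: vertices_DL \<sigma>_\<theta>)
  qed
  then show "\<sigma> x \<in> Bij (vertices DL)" by (simp add: Bij_def \<sigma>_def)
  fix v w assume "v \<in> vertices DL" "w \<in> vertices DL"
  then obtain g h where gh: "g \<in> carrier G" "h \<in> carrier G" "v = \<theta> g" "w = \<theta> h" by (auto simp: vertices_DL)
  have inv: "inv (x \<otimes> g) \<otimes> (x \<otimes> h) = inv g \<otimes> h" if "g \<in> carrier G" "h \<in> carrier G" for g h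
    using x that by (simp add: inv_mult_group m_assoc inv_mult_cancel_left)
  have "c\<^sub>A (x \<otimes> g) = c\<^sub>A (x \<otimes> h) \<longleftrightarrow> c\<^sub>A g = c\<^sub>A h" "S.c\<^sub>A (x \<otimes> g) = S.c\<^sub>A (x \<otimes> h) \<longleftrightarrow> S.c\<^sub>A g = S.c\<^sub>A h"
    if "g \<in> carrier G" "h \<in> carrier G" for g h
    using x that inv by (simp_all add: c\<^sub>A_eq_iff S.c\<^sub>A_eq_iff)
  then show "(\<sigma> x v, \<sigma> x w) \<in> adj DL \<longleftrightarrow> (v, w) \<in> adj DL"
    using gh x t by (simp add: \<sigma>_\<theta> adj_DL m_assoc)
qed (rule adj_DL_vertices)

theorem cross_wired: "cross_wired_lamplighter G"
proof -
  let ?I = "isometry_group DL"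
  interpret I: group ?I by (rule group_isometry_group)
  have hom: "\<sigma> \<in> hom G ?I"
  proof (rule homI)
    fix x y assume xy: "x \<in> carrier G" "y \<in> carrier G"
    have "\<sigma> (x \<otimes> y) v = compose (vertices DL) (\<sigma> x) (\<sigma> y) v" for v
    proof (cases "v \<in> vertices DL")
      case True
      then obtain g where "g \<in> carrier G" "v = \<theta> g" by (auto simp: vertices_DL)
      then show ?thesis using xy True by (simp add: compose_eq \<sigma>_\<theta> m_assoc)
    qed (simp add: compose_def \<sigma>_def)
    then show "\<sigma> (x \<otimes> y) = \<sigma> x \<otimes>\<^bsub>?I\<^esub> \<sigma> y" using xy by (simp add: isometries_mult \<sigma>_isometry fun_eq_iff)
  qed (simp add: \<sigma>_isometry)
  interpret h: group_hom G ?I \<sigma> using hom by unfold_locales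
  define L where "L = \<sigma> ` carrier G"
  \<comment> \<open>The orbit map of the base vertex \<open>\<theta> \<one>\<close> is
    \<open>\<theta>\<close> itself, so transitivity is \<open>vertices_DL\<close> and freeness is
    \<open>\<theta>_inj\<close>.\<close>
  have at_one: "\<sigma> x (\<theta> \<one>) = \<theta> x" if "x \<in> carrier G" for x using that by (simp add: \<sigma>_\<theta>)
  have L: "subgroup L ?I" unfolding L_def by (rule h.img_is_subgroup)
  interpret DL: locally_finite_graph DL
    using connected_DL adj_DL_vertices locally_finite_DL by unfold_locales
  have "cocompact_lattice ?I (pointwise_topology DL) L"
  proof (rule DL.simply_transitive_cocompact_lattice[OF L])
    show "\<theta> \<one> \<in> vertices DL" by (simp add: vertices_DL)
    show "\<exists>f\<in>L. f (\<theta> \<one>) = y" if "y \<in> vertices DL" for y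
      using that at_one by (auto simp: vertices_DL L_def)
    show "f = g" if fg: "f \<in> L" "g \<in> L" "f (\<theta> \<one>) = g (\<theta> \<one>)" for f g
      using fg at_one \<theta>_inj by (auto simp: L_def dest: inj_onD)
  qed
  moreover have "inj_on \<sigma> (carrier G)"
    by (rule inj_onI) (metis at_one \<theta>_inj inj_onD)
  then have "\<sigma> \<in> iso G (?I\<lparr>carrier := L\<rparr>)"
    using hom by (auto simp: iso_def bij_betw_def hom_def L_def)
  then have "G \<cong> ?I\<lparr>carrier := L\<rparr>" by (auto simp: is_iso_def)
  ultimately show ?thesis
    using diestel_leader_DL group_axioms unfolding cross_wired_lamplighter_def by blast
qed

end


section \<open>Groups generated by an expanding filtration\<close>

text \<open>What has to be known about the automata group: \<open>F n\<close> stands for the words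
  supported on the first \<open>n\<close> positions. \<open>F_conj\<close> says that
  \<open>k\<close> conjugations push every nontrivial element out of \<open>F k\<close>; it yields
  the trivial intersection of \<open>A\<close> and \<open>B\<close>, and with \<open>card_F\<close>
  the factorizations by counting. \<open>generated\<close> makes the height defined on the whole
  group.\<close>

locale expanding_filtration = group G for G (structure) +
  fixes t :: 'a and F :: "nat \<Rightarrow> 'a set" and q :: nat
  assumes t: "t \<in> carrier G" and F: "subgroup (F n) G"
    and q: "q \<ge> 2" and card_F: "card (F n) = q ^ n"
    and F_Suc: "F n \<subseteq> F (Suc n)"
    and contract: "x \<in> F n \<Longrightarrow> conj_pow t (-1) x \<in> F (Suc n)"
    and F_conj: "x \<in> F n \<Longrightarrow> conj_pow t (- int k) x \<in> F k \<Longrightarrow> x = \<one>"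
    and generated: "\<And>K. subgroup K G \<Longrightarrow> t \<in> K \<Longrightarrow> F 1 \<subseteq> K \<Longrightarrow> K = carrier G"
begin

lemma F_closed [simp]: "x \<in> F n \<Longrightarrow> x \<in> carrier G"
  using subgroup.mem_carrier[OF F] .

lemma F_mono: "m \<le> n \<Longrightarrow> F m \<subseteq> F n"
  using lift_Suc_mono_le[of F] F_Suc by blast

lemma finite_F: "finite (F n)"
  using card_F[of n] q by (intro card_ge_0_finite) simp

lemma conj_pow_Suc:
  "x \<in> carrier G \<Longrightarrow> conj_pow t (- int (Suc k)) x = conj_pow t (-1) (conj_pow t (- int k) x)"
  using t by (simp add: conj_pow_add)

lemma contract_pow: "x \<in> F n \<Longrightarrow> conj_pow t (- int k) x \<in> F (n + k)"
proof (induction k)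
  case (Suc k)
  then show ?case using contract by (simp add: conj_pow_Suc del: of_nat_Suc)
qed (simp add: t)

text \<open>The product map is injective, and both sides have \<open>q ^ (n + k)\<close> elements.\<close>

lemma F_decompose:
  assumes z: "z \<in> F (n + k)"
  shows "\<exists>x \<in> F k. \<exists>y \<in> F n. z = x \<otimes> conj_pow t (- int k) y"
proof -
  let ?f = "\<lambda>(x, y). x \<otimes> conj_pow t (- int k) y"
  have "inj_on ?f (F k \<times> F n)"
  proof (rule inj_onI, clarify)
    fix x y x' y'
    assume xy: "x \<in> F k" "y \<in> F n" "x' \<in> F k" "y' \<in> F n"
      and eq: "x \<otimes> conj_pow t (- int k) y = x' \<otimes> conj_pow t (- int k) y'"
    have c: "x \<in> carrier G" "y \<in> carrier G" "x' \<in> carrier G" "y' \<in> carrier G" using xy by simp_all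
    have "inv x' \<otimes> (x \<otimes> conj_pow t (- int k) y) \<otimes> inv (conj_pow t (- int k) y)
        = inv x' \<otimes> (x' \<otimes> conj_pow t (- int k) y') \<otimes> inv (conj_pow t (- int k) y)"
      by (simp only: eq)
    moreover have "inv x' \<otimes> (x \<otimes> conj_pow t (- int k) y) \<otimes> inv (conj_pow t (- int k) y) = inv x' \<otimes> x"
      using c t by (simp add: m_assoc)
    moreover have "inv x' \<otimes> (x' \<otimes> conj_pow t (- int k) y') \<otimes> inv (conj_pow t (- int k) y)
        = conj_pow t (- int k) (y' \<otimes> inv y)"
      using c t by (simp add: m_assoc[symmetric] conj_pow_mult conj_pow_inv)
    \<comment> \<open>Both sides now lie in \<open>F k\<close>, and the right one is a
      \<open>k\<close>-fold conjugate of an element of \<open>F n\<close>: the situation of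
      \<open>F_conj\<close>.\<close>
    ultimately have eq': "inv x' \<otimes> x = conj_pow t (- int k) (y' \<otimes> inv y)" by simp
    moreover have "inv x' \<otimes> x \<in> F k" "y' \<otimes> inv y \<in> F n"
      using xy F by (simp_all add: subgroup.m_closed subgroup.m_inv_closed)
    ultimately have "y' \<otimes> inv y = \<one>" using F_conj[of "y' \<otimes> inv y" n k] by simp
    then have "y = y'" "inv x' \<otimes> x = \<one>" using c t eq' by (simp_all add: inv_solve_right')
    then show "x = x' \<and> y = y'" using c by (metis inv_closed inv_equality inv_inv)
  qed
  then have "card (?f ` (F k \<times> F n)) = card (F (n + k))"
    by (simp add: card_image card_cartesian_product card_F power_add)
  moreover have "?f ` (F k \<times> F n) \<subseteq> F (n + k)"
    using contract_pow F_mono[of k "n + k"] F by (fastforce intro: subgroup.m_closed)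
  ultimately have "?f ` (F k \<times> F n) = F (n + k)" by (intro card_subset_eq finite_F)
  then have "z \<in> ?f ` (F k \<times> F n)" using z by simp
  then show ?thesis by auto
qed

lemma F_decompose':
  assumes z: "z \<in> F (n + k)"
  shows "\<exists>x \<in> F k. \<exists>y \<in> F n. z = conj_pow t (- int k) y \<otimes> x"
proof -
  have zc: "z \<in> carrier G" using z by simp
  obtain x y where xy: "x \<in> F k" "y \<in> F n" "inv z = x \<otimes> conj_pow t (- int k) y"
    using F_decompose[of "inv z" n k] z F by (auto simp: subgroup.m_inv_closed)
  have "z = inv (inv z)" using zc by simp
  also have "\<dots> = conj_pow t (- int k) (inv y) \<otimes> inv x"
    unfolding xy(3) using xy t by (simp add: inv_mult_group conj_pow_inv)
  finally show ?thesis using xy F by (metis subgroup.m_inv_closed)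
qed

section \<open>The limit subgroups\<close>

definition A where "A = (\<Union>n. F n)"

definition B where "B = (\<Union>n. conj_pow t (int n) ` F n)"

text \<open>The future kernel of the height, written as the ascending union of the conjugates
  \<open>t^i A t^-i\<close> so that it is visibly a subgroup; the factorization into
  \<open>A\<close> and \<open>B\<close> is \<open>decompose_N\<close>.\<close>

definition N where "N = {x \<in> carrier G. \<exists>i::nat. conj_pow t (- int i) x \<in> A}"

lemma subgroup_UN:
  assumes "\<And>n. subgroup (H n) G" "\<And>n. H n \<subseteq> H (Suc n)"
  shows "subgroup (\<Union>n::nat. H n) G"
proof (rule subgroupI)
  have mono: "m \<le> n \<Longrightarrow> H m \<subseteq> H n" for m n using lift_Suc_mono_le[of H] assms by blast
  show "(\<Union>n. H n) \<subseteq> carrier G" using assms(1) subgroup.subset by blast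
  show "(\<Union>n. H n) \<noteq> {}" using subgroup.one_closed[OF assms(1)] by blast
  show "inv x \<in> (\<Union>n. H n)" if "x \<in> (\<Union>n. H n)" for x
    using that subgroup.m_inv_closed[OF assms(1)] by blast
  fix x y assume "x \<in> (\<Union>n. H n)" "y \<in> (\<Union>n. H n)"
  then obtain m n where "x \<in> H m" "y \<in> H n" by blast
  then have "x \<in> H (max m n)" "y \<in> H (max m n)" using mono[of m "max m n"] mono[of n "max m n"] by auto
  then have "x \<otimes> y \<in> H (max m n)" using subgroup.m_closed[OF assms(1)] by blast
  then show "x \<otimes> y \<in> (\<Union>n. H n)" by blast
qed

lemma subgroup_A: "subgroup A G"
  unfolding A_def by (rule subgroup_UN) (rule F, rule F_Suc)

lemma A_closed [simp]: "x \<in> A \<Longrightarrow> x \<in> carrier G"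
  using subgroup.mem_carrier[OF subgroup_A] .

lemma subgroup_vimage_conj:
  assumes K: "subgroup K G"
  shows "subgroup {x \<in> carrier G. conj_pow t k x \<in> K} G"
  by (rule subgroupI)
    (use K t subgroup.one_closed[OF K] in \<open>auto simp: conj_pow_mult conj_pow_inv subgroup.m_closed subgroup.m_inv_closed\<close>)

lemma image_conj:
  "K \<subseteq> carrier G \<Longrightarrow> conj_pow t k ` K = {x \<in> carrier G. conj_pow t (- k) x \<in> K}"
  by (force simp: conj_pow_add t image_iff)

lemma B_eq: "B = (\<Union>n. {x \<in> carrier G. conj_pow t (- int n) x \<in> F n})"
  unfolding B_def using image_conj[of "F _"] by (simp add: subgroup.subset[OF F])

lemma subgroup_B: "subgroup B G"
  unfolding B_eq
proof (rule subgroup_UN, rule subgroup_vimage_conj[OF F])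
  fix n show "{x \<in> carrier G. conj_pow t (- int n) x \<in> F n} \<subseteq> {x \<in> carrier G. conj_pow t (- int (Suc n)) x \<in> F (Suc n)}"
    using contract[of _ n] by (auto simp: conj_pow_Suc simp del: of_nat_Suc)
qed

lemma contract_A: "a \<in> A \<Longrightarrow> conj_pow t (-1) a \<in> A"
  using contract by (auto simp: A_def)

lemma subgroup_N: "subgroup N G"
proof -
  have "N = (\<Union>n. {x \<in> carrier G. conj_pow t (- int n) x \<in> A})" by (auto simp: N_def)
  also have "subgroup \<dots> G"
  proof (rule subgroup_UN, rule subgroup_vimage_conj[OF subgroup_A])
    fix n show "{x \<in> carrier G. conj_pow t (- int n) x \<in> A} \<subseteq> {x \<in> carrier G. conj_pow t (- int (Suc n)) x \<in> A}"
      using contract_A by (auto simp: conj_pow_Suc simp del: of_nat_Suc)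
  qed
  finally show ?thesis .
qed

lemma N_closed [simp]: "x \<in> N \<Longrightarrow> x \<in> carrier G"
  using subgroup.mem_carrier[OF subgroup_N] .

lemma A_subset_N: "A \<subseteq> N"
proof
  fix a assume a: "a \<in> A"
  then have "conj_pow t (- int 0) a \<in> A" by (simp add: t)
  then show "a \<in> N" using A_closed[OF a] unfolding N_def by blast
qed

lemma B_subset_N: "B \<subseteq> N"
  unfolding B_eq N_def A_def by blast

text \<open>Conjugating back by \<open>\<bar>k\<bar>\<close> more steps makes the remaining exponent
  \<open>\<bar>k\<bar> - k\<close> a natural number, so only the contracting direction is
  used.\<close>

lemma conj_N:
  assumes x: "x \<in> N"
  shows "conj_pow t k x \<in> N"
proof -
  obtain i n where i: "conj_pow t (- int i) x \<in> F n" using x unfolding N_def A_def by blast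
  have "- int (nat \<bar>k\<bar> + i) + k = - int (nat (\<bar>k\<bar> - k)) + - int i" by simp
  then have "conj_pow t (- int (nat \<bar>k\<bar> + i)) (conj_pow t k x)
      = conj_pow t (- int (nat (\<bar>k\<bar> - k))) (conj_pow t (- int i) x)"
    by (simp only: conj_pow_add[OF t N_closed[OF x]])
  also have "\<dots> \<in> A" using contract_pow[OF i] unfolding A_def by blast
  finally show ?thesis using conj_pow_closed[OF t N_closed[OF x]] unfolding N_def by blast
qed

section \<open>The height homomorphism\<close>

lemma one_F: "\<one> \<in> F n"
  by (rule subgroup.one_closed[OF F])

lemma F_1_nontrivial: "\<exists>y \<in> F 1. y \<noteq> \<one>"
proof (rule ccontr)
  assume "\<not> ?thesis"
  then have "F 1 = {\<one>}" using one_F by blast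
  then show False using card_F[of 1] q by simp
qed

text \<open>Powers of \<open>t\<close> are fixed under conjugation by \<open>t\<close>, so one that
  lies in \<open>N\<close> lies in some \<open>F n\<close> and is trivial by \<open>F_conj\<close>.
  But then \<open>t^m = \<one>\<close> with \<open>m > 0\<close>, and conjugation by it fixes a
  nontrivial element of \<open>F 1\<close>, again against \<open>F_conj\<close>.\<close>

lemma t_pow_notin_N:
  assumes N: "t [^] (k::int) \<in> N"
  shows "k = 0"
proof (rule ccontr)
  assume "k \<noteq> 0"
  define m where "m = nat \<bar>k\<bar>"
  have conj: "conj_pow t j (t [^] (i::int)) = t [^] i" for i j
    using t by (simp add: conj_pow_def flip: int_pow_mult)
  have "t [^] (- int m) \<in> N"
    using N t subgroup.m_inv_closed[OF subgroup_N N] by (cases "k \<ge> 0") (simp_all add: m_def int_pow_neg)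
  then obtain i n where "conj_pow t (- int i) (t [^] (- int m)) \<in> F n" unfolding N_def A_def by blast
  then have "t [^] (- int m) \<in> F n" by (simp only: conj)
  then have "t [^] (- int m) = \<one>"
    using F_conj[of "t [^] (- int m)" n n] conj by simp
  moreover from this have "t [^] int m = \<one>" using t by (simp add: int_pow_neg)
  moreover obtain y where y: "y \<in> F 1" "y \<noteq> \<one>" using F_1_nontrivial by blast
  ultimately have "conj_pow t (- int m) y = y" by (simp add: conj_pow_def)
  moreover have "1 \<le> m" using \<open>k \<noteq> 0\<close> by (simp add: m_def)
  then have "y \<in> F m" using y(1) F_mono[of 1 m] by blast
  ultimately show False using F_conj[of y 1 m] y by simp
qed

text \<open>As \<open>t\<close> normalizes \<open>N\<close>, the products \<open>n t^k\<close> form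
  a subgroup; it contains \<open>t\<close> and \<open>F 1\<close>, hence everything.\<close>

lemma N_pow_exists:
  assumes x: "x \<in> carrier G"
  shows "\<exists>k::int. x \<otimes> t [^] (- k) \<in> N"
proof -
  define K where "K = {x \<in> carrier G. \<exists>k::int. x \<otimes> t [^] (- k) \<in> N}"
  have KI: "n \<otimes> t [^] (k::int) \<in> K" if "n \<in> N" for n k
    using that t by (auto simp: K_def m_assoc intro!: exI[of _ k] simp flip: int_pow_mult)
  have KE: "\<exists>n \<in> N. \<exists>k::int. x = n \<otimes> t [^] k" if xK: "x \<in> K" for x
  proof -
    obtain k :: int where "x \<in> carrier G" "x \<otimes> t [^] (- k) \<in> N" using xK unfolding K_def by blast
    moreover from this have "x = (x \<otimes> t [^] (- k)) \<otimes> t [^] k" using t by (simp add: m_assoc flip: int_pow_mult)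
    ultimately show ?thesis by blast
  qed
  have "subgroup K G"
  proof (rule subgroupI)
    show "K \<subseteq> carrier G" by (auto simp: K_def)
    have tK: "t \<in> K" using KI[of \<one> 1] t subgroup.one_closed[OF subgroup_N] by (simp add: int_pow_1)
    then show "K \<noteq> {}" by blast
    fix x assume "x \<in> K"
    then obtain n k where x: "n \<in> N" "x = n \<otimes> t [^] (k::int)" using KE by blast
    have "inv x = conj_pow t (- k) (inv n) \<otimes> t [^] (- k)"
      using x t by (simp add: inv_mult_group conj_pow_def m_assoc int_pow_neg)
    then show "inv x \<in> K" using KI conj_N x subgroup.m_inv_closed[OF subgroup_N] by simp
    fix y assume "y \<in> K"
    then obtain m l where y: "m \<in> N" "y = m \<otimes> t [^] (l::int)" using KE by blast
    have "x \<otimes> y = (n \<otimes> conj_pow t k m) \<otimes> t [^] (k + l)"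
    proof -
      have "t [^] (- k) \<otimes> (t [^] (k + l)) = t [^] l" using t by (simp flip: int_pow_mult)
      then show ?thesis using x y t by (simp add: conj_pow_def m_assoc)
    qed
    then show "x \<otimes> y \<in> K" using KI conj_N x y subgroup.m_closed[OF subgroup_N] by simp
  qed
  moreover have "t \<in> K" using KI[of \<one> 1] t subgroup.one_closed[OF subgroup_N] by (simp add: int_pow_1)
  moreover have "F 1 \<subseteq> K"
  proof
    fix y assume y: "y \<in> F 1"
    then have "y \<in> N" using A_subset_N by (auto simp: A_def)
    then show "y \<in> K" using KI[of y 0] y by simp
  qed
  ultimately have "K = carrier G" by (rule generated)
  then show ?thesis using x by (auto simp: K_def)
qed

text \<open>The projection of the semidirect product of \<open>N\<close> and the powers of
  \<open>t\<close>. Existence of \<open>k\<close> is \<open>N_pow_exists\<close>, uniqueness comes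
  from \<open>t_pow_notin_N\<close>.\<close>

definition \<pi> where "\<pi> x = (THE k::int. x \<otimes> t [^] (- k) \<in> N)"

lemma \<pi>_eq:
  assumes x: "x \<in> carrier G" and k: "x \<otimes> t [^] (- k) \<in> N"
  shows "\<pi> x = k"
  unfolding \<pi>_def
proof (rule the_equality, rule k)
  fix l :: int assume l: "x \<otimes> t [^] (- l) \<in> N"
  have "inv (x \<otimes> t [^] (- k)) \<otimes> (x \<otimes> t [^] (- l)) \<in> N"
    using k l subgroup_N by (simp add: subgroup.m_closed subgroup.m_inv_closed)
  also have "inv (x \<otimes> t [^] (- k)) \<otimes> (x \<otimes> t [^] (- l)) = t [^] k \<otimes> t [^] (- l)"
  proof -
    have "inv (x \<otimes> t [^] (- k)) = t [^] k \<otimes> inv x" using x t by (simp add: inv_mult_group int_pow_neg)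
    moreover have "a \<otimes> inv x \<otimes> (x \<otimes> b) = a \<otimes> b" if "a \<in> carrier G" "b \<in> carrier G" for a b
      using x that by (simp add: m_assoc inv_mult_cancel_left)
    ultimately show ?thesis using t by simp
  qed
  also have "\<dots> = t [^] (k - l)" using t by (simp flip: int_pow_mult)
  finally show "l = k" using t_pow_notin_N[of "k - l"] by simp
qed

lemma \<pi>_N:
  assumes x: "x \<in> carrier G"
  shows "x \<otimes> t [^] (- \<pi> x) \<in> N"
proof -
  obtain k :: int where k: "x \<otimes> t [^] (- k) \<in> N" using N_pow_exists[OF x] by blast
  then show ?thesis by (simp only: \<pi>_eq[OF x k])
qed

lemma \<pi>_eq_0_iff:
  assumes x: "x \<in> carrier G"
  shows "\<pi> x = 0 \<longleftrightarrow> x \<in> N"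
proof -
  have x0: "x \<otimes> t [^] (- 0 :: int) = x" using x by simp
  show ?thesis
  proof
    show "x \<in> N" if "\<pi> x = 0" using \<pi>_N[OF x] by (simp only: that x0)
    show "\<pi> x = 0" if "x \<in> N" by (rule \<pi>_eq[OF x]) (simp only: that x0)
  qed
qed

text \<open>Collecting powers of \<open>t\<close> on the right conjugates the \<open>N\<close>-part
  of \<open>y\<close> by \<open>t\<close> to the power \<open>\<pi> x\<close>, which
  \<open>conj_N\<close> permits.\<close>

lemma \<pi>_mult:
  assumes x: "x \<in> carrier G" and y: "y \<in> carrier G"
  shows "\<pi> (x \<otimes> y) = \<pi> x + \<pi> y"
proof (rule \<pi>_eq)
  have "t [^] (- (\<pi> x + \<pi> y)) = t [^] (- \<pi> y) \<otimes> t [^] (- \<pi> x)"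
    using t by (simp add: add.commute flip: int_pow_mult)
  moreover have "t [^] (- \<pi> x) \<otimes> (t [^] \<pi> x \<otimes> z) = z" if "z \<in> carrier G" for z
    using t that by (simp add: m_assoc[symmetric] flip: int_pow_mult)
  ultimately have "x \<otimes> y \<otimes> t [^] (- (\<pi> x + \<pi> y)) = (x \<otimes> t [^] (- \<pi> x)) \<otimes> conj_pow t (\<pi> x) (y \<otimes> t [^] (- \<pi> y))"
    using x y t by (simp add: conj_pow_def m_assoc)
  also have "\<dots> \<in> N" using \<pi>_N[OF x] conj_N[OF \<pi>_N[OF y]] subgroup.m_closed[OF subgroup_N] by blast
  finally show "x \<otimes> y \<otimes> t [^] (- (\<pi> x + \<pi> y)) \<in> N" .
qed (use x y in simp)

lemma countable_carrier: "countable (carrier G)"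
proof -
  have "carrier G \<subseteq> (\<lambda>(a, i, k). conj_pow t i a \<otimes> t [^] k) ` (A \<times> (UNIV :: int set) \<times> (UNIV :: int set))"
  proof
    fix x assume x: "x \<in> carrier G"
    then obtain i where i: "conj_pow t (- int i) (x \<otimes> t [^] (- \<pi> x)) \<in> A" using \<pi>_N[OF x] unfolding N_def by blast
    show "x \<in> (\<lambda>(a, i, k). conj_pow t i a \<otimes> t [^] k) ` (A \<times> (UNIV :: int set) \<times> (UNIV :: int set))"
    proof (rule image_eqI)
      show "x = (\<lambda>(a, i, k). conj_pow t i a \<otimes> t [^] k)
          (conj_pow t (- int i) (x \<otimes> t [^] (- \<pi> x)), int i, \<pi> x)"
        using x t by (simp add: conj_pow_add m_assoc flip: int_pow_mult)
    qed (use i in simp)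
  qed
  moreover have "countable A" unfolding A_def using finite_F by (simp add: countable_finite)
  then have "countable ((\<lambda>(a, i, k). conj_pow t i a \<otimes> t [^] k) ` (A \<times> (UNIV :: int set) \<times> (UNIV :: int set)))"
    by simp
  ultimately show ?thesis using countable_subset by blast
qed

lemma A_Int_B: "A \<inter> B = {\<one>}"
proof -
  have "\<one> \<in> A \<inter> B" using subgroup.one_closed[OF subgroup_A] subgroup.one_closed[OF subgroup_B] by blast
  moreover have "x = \<one>" if "x \<in> A" "x \<in> B" for x
    using that F_conj by (auto simp: A_def B_eq)
  ultimately show ?thesis by blast
qed

text \<open>Conjugate \<open>x\<close> into \<open>F n\<close>, factor it there inside the larger
  \<open>F (n + i)\<close>, and conjugate back: the factor from \<open>F n\<close> ends in
  \<open>A\<close>, the one from \<open>F i\<close> in \<open>t^i F i t^-i\<close>, a part of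
  \<open>B\<close>.\<close>

lemma decompose_N:
  assumes x: "x \<in> N"
  shows "\<exists>a \<in> A. \<exists>b \<in> B. x = a \<otimes> b"
proof -
  obtain i n where i: "conj_pow t (- int i) x \<in> F n" using x unfolding N_def A_def by blast
  then obtain y z where yz: "y \<in> F i" "z \<in> F n" "conj_pow t (- int i) x = conj_pow t (- int i) z \<otimes> y"
    using F_decompose'[of _ n i] F_mono[of n "n + i"] by fastforce
  have "x = conj_pow t (int i) (conj_pow t (- int i) x)" using x t by (simp add: conj_pow_add)
  also have "\<dots> = z \<otimes> conj_pow t (int i) y"
    unfolding yz(3) using yz t by (simp add: conj_pow_mult conj_pow_add)
  finally show ?thesis using yz by (auto simp: A_def B_def)
qed

lemma exhaust_B:
  assumes x: "x \<in> N"
  shows "\<exists>k. conj_pow t (int k) x \<in> B"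
proof -
  obtain i n where i: "conj_pow t (- int i) x \<in> F n" using x unfolding N_def A_def by blast
  then have "conj_pow t (- int i) x \<in> F (i + n)" using F_mono[of n "i + n"] by auto
  then have "conj_pow t (int (i + n)) (conj_pow t (- int i) x) \<in> B" unfolding B_def by blast
  moreover have "conj_pow t (int (i + n)) (conj_pow t (- int i) x) = conj_pow t (int n) x"
    using x t by (simp add: conj_pow_add)
  ultimately show ?thesis by metis
qed

lemma contract_B: "b \<in> B \<Longrightarrow> conj_pow t 1 b \<in> B"
proof -
  assume "b \<in> B"
  then obtain n x where x: "x \<in> F n" "b = conj_pow t (int n) x" by (auto simp: B_def)
  then have "conj_pow t 1 b = conj_pow t (int (Suc n)) x" using t by (simp add: conj_pow_add)
  moreover have "x \<in> F (Suc n)" using x F_Suc by blast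
  ultimately show ?thesis unfolding B_def by blast
qed

text \<open>Identifies the transversal of the coset trees, so that the branching number is
  \<open>q\<close>.\<close>

lemma F_1_eq: "{d \<in> A. conj_pow t 1 d \<in> B} = F 1"
proof (intro equalityI subsetI)
  fix d assume "d \<in> F 1"
  then show "d \<in> {d \<in> A. conj_pow t 1 d \<in> B}" by (force simp: A_def B_def)
next
  fix d assume "d \<in> {d \<in> A. conj_pow t 1 d \<in> B}"
  then obtain n where d: "d \<in> A" "conj_pow t (- int n) (conj_pow t 1 d) \<in> F n" by (auto simp: B_eq)
  then have dn: "conj_pow t (1 - int n) d \<in> F n" by (simp add: conj_pow_add t)
  show "d \<in> F 1"
  proof (cases n)
    case 0
    have "conj_pow t 1 d = \<one>" using dn card_F[of 0] one_F[of 0] 0 by (auto simp: card_1_singleton_iff)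
    then have "d = \<one>" using conj_pow_cancel[OF t, of d \<one> 1] d t by simp
    then show ?thesis using one_F by simp
  next
    \<comment> \<open>Factoring in \<open>F (1 + m)\<close> writes \<open>d\<close> as an element of
      \<open>B\<close> times one of \<open>F 1\<close>; the first factor then also lies in
      \<open>A\<close>, so it is trivial.\<close>
    case (Suc m)
    then obtain x y where xy: "x \<in> F m" "y \<in> F 1" "conj_pow t (- int m) d = x \<otimes> conj_pow t (- int m) y"
      using F_decompose[of "conj_pow t (- int m) d" 1 m] dn by auto
    have "d = conj_pow t (int m) (conj_pow t (- int m) d)" using d t by (simp add: conj_pow_add)
    also have "\<dots> = conj_pow t (int m) x \<otimes> y"
      unfolding xy(3) using xy t by (simp add: conj_pow_mult conj_pow_add)
    finally have dxy: "d = conj_pow t (int m) x \<otimes> y" .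
    then have "d \<otimes> inv y = conj_pow t (int m) x" using xy t by (simp add: m_assoc)
    moreover have "y \<in> A" using xy unfolding A_def by blast
    then have "d \<otimes> inv y \<in> A"
      using d subgroup_A by (simp add: subgroup.m_closed subgroup.m_inv_closed)
    moreover have "conj_pow t (int m) x \<in> B" using xy by (auto simp: B_def)
    ultimately have "conj_pow t (int m) x = \<one>" using A_Int_B by auto
    then show ?thesis using dxy xy by simp
  qed
qed

theorem cross_wired: "cross_wired_lamplighter G"
proof -
  interpret horo: horocyclic_group G t A B \<pi>
  proof (intro horocyclic_group.intro group_axioms horocyclic_group_axioms.intro)
    show "\<pi> t = 1"
      using subgroup.one_closed[OF subgroup_N] t by (intro \<pi>_eq) (simp_all add: int_pow_neg int_pow_1)
    show "\<pi> a = 0" if "a \<in> A" for a using that A_subset_N \<pi>_eq_0_iff[of a] by auto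
    show "\<pi> b = 0" if "b \<in> B" for b using that B_subset_N \<pi>_eq_0_iff[of b] by auto
    show "\<exists>k. conj_pow t (- int k) x \<in> A" if "x \<in> carrier G" "\<pi> x = 0" for x
      using that \<pi>_eq_0_iff[of x] unfolding N_def by blast
    show "\<exists>k. conj_pow t (int k) x \<in> B" if "x \<in> carrier G" "\<pi> x = 0" for x
      using that exhaust_B \<pi>_eq_0_iff[of x] by blast
    show "\<exists>a\<in>A. \<exists>b\<in>B. x = a \<otimes> b" if "x \<in> carrier G" "\<pi> x = 0" for x
      using that decompose_N \<pi>_eq_0_iff[of x] by blast
    show "2 \<le> card {d \<in> A. conj_pow t 1 d \<in> B}" unfolding F_1_eq using card_F[of 1] q by simp
  qed (fact t subgroup_A subgroup_B countable_carrier \<pi>_mult contract_A contract_B A_Int_B)+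
  show ?thesis by (rule horo.cross_wired)
qed

end


section \<open>The Cayley machine\<close>

locale square_central_group = group G for G (structure) +
  assumes commutator_central: "x \<in> carrier G \<Longrightarrow> y \<in> carrier G \<Longrightarrow>
      x \<otimes> y \<otimes> inv x \<otimes> inv y \<in> group_center G"
    and square_central: "x \<in> carrier G \<Longrightarrow> x \<otimes> x \<in> group_center G"
begin

abbreviation Z where "Z \<equiv> group_center G"

definition \<kappa> where "\<kappa> x y = x \<otimes> y \<otimes> inv x \<otimes> inv y"

lemma Z_closed [simp]: "z \<in> Z \<Longrightarrow> z \<in> carrier G"
  unfolding group_center_def by blast

lemma Z_comm: "z \<in> Z \<Longrightarrow> x \<in> carrier G \<Longrightarrow> z \<otimes> x = x \<otimes> z"
  unfolding group_center_def by blast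

lemma Z_mult [simp]:
  assumes "z \<in> Z" "w \<in> Z"
  shows "z \<otimes> w \<in> Z"
proof -
  have "z \<otimes> w \<otimes> x = x \<otimes> (z \<otimes> w)" if "x \<in> carrier G" for x
    using assms that by (metis Z_closed Z_comm m_assoc)
  then show ?thesis using assms unfolding group_center_def by blast
qed

lemma Z_one [simp]: "\<one> \<in> Z"
  unfolding group_center_def by simp

lemma Z_lcomm: "z \<in> Z \<Longrightarrow> w \<in> Z \<Longrightarrow> x \<in> carrier G \<Longrightarrow> z \<otimes> (w \<otimes> x) = w \<otimes> (z \<otimes> x)"
  by (metis Z_closed Z_comm m_assoc)

lemma Z_comm_Z: "z \<in> Z \<Longrightarrow> w \<in> Z \<Longrightarrow> z \<otimes> w = w \<otimes> z"
  by (simp add: Z_comm)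

lemma Z_pull: "z \<in> Z \<Longrightarrow> x \<in> carrier G \<Longrightarrow> y \<in> carrier G \<Longrightarrow> x \<otimes> (z \<otimes> y) = z \<otimes> (x \<otimes> y)"
  by (metis Z_closed Z_comm m_assoc)

lemma \<kappa>_Z [simp]: "x \<in> carrier G \<Longrightarrow> y \<in> carrier G \<Longrightarrow> \<kappa> x y \<in> Z"
  unfolding \<kappa>_def by (rule commutator_central)

lemma \<kappa>_closed [simp]: "x \<in> carrier G \<Longrightarrow> y \<in> carrier G \<Longrightarrow> \<kappa> x y \<in> carrier G"
  by simp

lemma \<kappa>_swap: "x \<in> carrier G \<Longrightarrow> y \<in> carrier G \<Longrightarrow> x \<otimes> y = \<kappa> x y \<otimes> (y \<otimes> x)"
  by (simp add: \<kappa>_def m_assoc inv_mult_cancel_left)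

lemma \<kappa>_unique: "x \<in> carrier G \<Longrightarrow> y \<in> carrier G \<Longrightarrow> k \<in> carrier G \<Longrightarrow> x \<otimes> y = k \<otimes> (y \<otimes> x) \<Longrightarrow> \<kappa> x y = k"
  by (metis \<kappa>_closed \<kappa>_swap m_closed right_cancel)

lemma \<kappa>_mult_left:
  assumes "x \<in> carrier G" "y \<in> carrier G" "z \<in> carrier G"
  shows "\<kappa> (x \<otimes> y) z = \<kappa> x z \<otimes> \<kappa> y z"
proof (rule \<kappa>_unique)
  have "x \<otimes> y \<otimes> z = x \<otimes> (\<kappa> y z \<otimes> (z \<otimes> y))"
    using assms \<kappa>_swap[of y z] by (simp add: m_assoc)
  also have "\<dots> = \<kappa> y z \<otimes> ((x \<otimes> z) \<otimes> y)"
    using assms Z_pull[of "\<kappa> y z" x "z \<otimes> y"] by (simp add: m_assoc)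
  also have "\<dots> = \<kappa> y z \<otimes> (\<kappa> x z \<otimes> (z \<otimes> x) \<otimes> y)" using assms \<kappa>_swap[of x z] by simp
  also have "\<dots> = \<kappa> x z \<otimes> \<kappa> y z \<otimes> (z \<otimes> (x \<otimes> y))"
    using assms by (simp add: m_assoc Z_lcomm)
  finally show "x \<otimes> y \<otimes> z = \<kappa> x z \<otimes> \<kappa> y z \<otimes> (z \<otimes> (x \<otimes> y))" .
qed (use assms in simp_all)

lemma \<kappa>_inv: "x \<in> carrier G \<Longrightarrow> y \<in> carrier G \<Longrightarrow> \<kappa> y x = inv (\<kappa> x y)"
  by (simp add: \<kappa>_def inv_mult_group m_assoc)

lemma \<kappa>_Z_left: "z \<in> Z \<Longrightarrow> x \<in> carrier G \<Longrightarrow> \<kappa> z x = \<one>"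
  by (rule \<kappa>_unique) (simp_all add: Z_comm)

lemma \<kappa>_Z_right: "z \<in> Z \<Longrightarrow> x \<in> carrier G \<Longrightarrow> \<kappa> x z = \<one>"
  by (rule \<kappa>_unique) (simp_all add: Z_comm)

text \<open>By bimultiplicativity the square is \<open>\<kappa> (x \<otimes> x) y\<close>, and
  \<open>x \<otimes> x\<close> is central.\<close>

lemma \<kappa>_twice: "x \<in> carrier G \<Longrightarrow> y \<in> carrier G \<Longrightarrow> \<kappa> x y \<otimes> \<kappa> x y = \<one>"
  using \<kappa>_mult_left[of x x y] \<kappa>_Z_left[OF square_central[of x], of y] by simp

lemma \<kappa>_sym: "x \<in> carrier G \<Longrightarrow> y \<in> carrier G \<Longrightarrow> \<kappa> y x = \<kappa> x y"
  using \<kappa>_twice[of x y] \<kappa>_inv[of x y] by (simp add: inv_equality)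

lemma \<kappa>_mult_right:
  assumes "x \<in> carrier G" "y \<in> carrier G" "z \<in> carrier G"
  shows "\<kappa> x (y \<otimes> z) = \<kappa> x y \<otimes> \<kappa> x z"
  using assms \<kappa>_mult_left[of y z x] by (simp add: \<kappa>_sym)

lemma \<kappa>_one [simp]: "x \<in> carrier G \<Longrightarrow> \<kappa> \<one> x = \<one>" "x \<in> carrier G \<Longrightarrow> \<kappa> x \<one> = \<one>"
  by (simp_all add: \<kappa>_Z_left \<kappa>_Z_right)

text \<open>An ordered product, as \<open>G\<close> need not be commutative; it is applied to
  central factors.\<close>

primrec cprod :: "(nat \<Rightarrow> 'a) \<Rightarrow> nat \<Rightarrow> 'a" where
  "cprod f 0 = \<one>"
| "cprod f (Suc n) = cprod f n \<otimes> f n"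

lemma cprod_Z: "(\<And>i. i < n \<Longrightarrow> f i \<in> Z) \<Longrightarrow> cprod f n \<in> Z"
  by (induction n) simp_all

lemma cprod_cong: "(\<And>i. i < n \<Longrightarrow> f i = g i) \<Longrightarrow> cprod f n = cprod g n"
  by (induction n) simp_all

lemma cprod_one: "(\<And>i. i < n \<Longrightarrow> f i = \<one>) \<Longrightarrow> cprod f n = \<one>"
  by (induction n) simp_all

lemma cprod_mult:
  "(\<And>i. i < n \<Longrightarrow> f i \<in> Z) \<Longrightarrow> (\<And>i. i < n \<Longrightarrow> g i \<in> Z) \<Longrightarrow>
   cprod (\<lambda>i. f i \<otimes> g i) n = cprod f n \<otimes> cprod g n"
proof (induction n)
  case (Suc n)
  have "cprod f n \<in> Z" "cprod g n \<in> Z" "f n \<in> Z" "g n \<in> Z" using Suc.prems by (simp_all add: cprod_Z)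
  then show ?case using Suc by (simp add: m_assoc Z_lcomm)
qed simp

section \<open>The twisted group law on infinite words\<close>

abbreviation W where "W \<equiv> omega_words (carrier G)"

lemma W_closed [simp]: "a \<in> W \<Longrightarrow> a n \<in> carrier G"
  by (simp add: omega_words_def)

definition C where
  "C u a n = cprod (\<lambda>i. \<kappa> (a i) (u (2 * n - 1 - i) \<otimes> u (2 * n - i))) n"

definition star where
  "star u a n = u n \<otimes> a n \<otimes> C u a n"

lemma C_Z [simp]: "u \<in> W \<Longrightarrow> a \<in> W \<Longrightarrow> C u a n \<in> Z"
  by (simp add: C_def cprod_Z)

lemma C_closed [simp]: "u \<in> W \<Longrightarrow> a \<in> W \<Longrightarrow> C u a n \<in> carrier G"
  by simp

lemma star_W [simp]: "u \<in> W \<Longrightarrow> a \<in> W \<Longrightarrow> star u a \<in> W"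
  by (subst omega_words_def) (simp add: star_def)

lemma one_W [simp]: "(\<lambda>_. \<one>) \<in> W"
  unfolding omega_words_def by simp

text \<open>\<open>\<kappa>\<close> ignores central factors, so the correction inside
  \<open>star u v\<close> drops out. Together with \<open>C_star_right\<close> this is the cocycle
  identity behind \<open>star_assoc\<close>.\<close>

lemma C_star_left:
  assumes "u \<in> W" "v \<in> W" "a \<in> W"
  shows "C (star u v) a n = C u a n \<otimes> C v a n"
proof -
  have "\<kappa> x (star u v i \<otimes> star u v j) = \<kappa> x (u i \<otimes> u j) \<otimes> \<kappa> x (v i \<otimes> v j)"
    if "x \<in> carrier G" for x i j
    using assms that by (simp add: star_def \<kappa>_mult_right \<kappa>_Z_right m_assoc Z_lcomm)
  then show ?thesis using assms by (simp add: C_def cprod_mult)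
qed

lemma C_star_right:
  assumes "u \<in> W" "v \<in> W" "a \<in> W"
  shows "C u (star v a) n = C u v n \<otimes> C u a n"
proof -
  have "\<kappa> (star v a i) x = \<kappa> (v i) x \<otimes> \<kappa> (a i) x" if "x \<in> carrier G" for x i
    using assms that by (simp add: star_def \<kappa>_mult_left \<kappa>_Z_left)
  then show ?thesis using assms by (simp add: C_def[of u] cprod_mult)
qed

lemma C_one [simp]: "u \<in> W \<Longrightarrow> C u (\<lambda>_. \<one>) n = \<one>" "u \<in> W \<Longrightarrow> C (\<lambda>_. \<one>) u n = \<one>"
  by (simp_all add: C_def cprod_one)

lemma star_assoc:
  assumes "u \<in> W" "v \<in> W" "a \<in> W"
  shows "star (star u v) a = star u (star v a)"
proof
  fix n
  have "u n \<otimes> v n \<otimes> C u v n \<otimes> a n \<otimes> (C u a n \<otimes> C v a n)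
      = u n \<otimes> (v n \<otimes> a n \<otimes> C v a n) \<otimes> (C u v n \<otimes> C u a n)"
    using assms Z_comm[of "C u v n" "a n"] by (simp add: m_assoc Z_pull Z_lcomm Z_comm_Z)
  then show "star (star u v) a n = star u (star v a) n"
    using assms by (simp add: star_def[of "star u v"] star_def[of u "star v a"] C_star_left C_star_right)
      (simp add: star_def)
qed

lemma star_one: "u \<in> W \<Longrightarrow> star u (\<lambda>_. \<one>) = u" "u \<in> W \<Longrightarrow> star (\<lambda>_. \<one>) u = u"
  by (simp_all add: star_def fun_eq_iff)

text \<open>Inverting letters leaves \<open>\<kappa>\<close> unchanged because its values have order
  at most two, so \<open>C (star_inv u) u\<close> is \<open>C u u\<close>, which cancels with
  itself.\<close>

definition star_inv where "star_inv u n = inv (u n) \<otimes> C u u n"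

lemma star_inv:
  assumes "u \<in> W"
  shows "star_inv u \<in> W" "star (star_inv u) u = (\<lambda>_. \<one>)"
proof -
  show W: "star_inv u \<in> W" using assms by (subst omega_words_def) (simp add: star_inv_def)
  have "\<kappa> x (inv y \<otimes> z) = \<kappa> x y" if "x \<in> carrier G" "y \<in> carrier G" "z \<in> Z" for x y z
  proof -
    have "\<kappa> x (inv y) \<otimes> \<kappa> x y = \<one>" using that \<kappa>_mult_right[of x "inv y" y] by simp
    then have "\<kappa> x (inv y) = inv (\<kappa> x y)" using that by (simp add: inv_equality)
    also have "\<dots> = \<kappa> x y" using that \<kappa>_sym \<kappa>_inv by metis
    finally show ?thesis using that by (simp add: \<kappa>_mult_right \<kappa>_Z_right)
  qed
  then have "\<kappa> x (star_inv u j) = \<kappa> x (u j)" if "x \<in> carrier G" for x j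
    using that assms unfolding star_inv_def by simp
  then have "C (star_inv u) u n = C u u n" for n
    using assms W by (simp add: C_def \<kappa>_mult_right)
  moreover have "C u u n \<otimes> C u u n = \<one>" for n
    using assms by (simp add: C_def \<kappa>_twice cprod_one flip: cprod_mult)
  moreover have "inv (u n) \<otimes> C u u n \<otimes> u n = C u u n" for n
    using assms Z_comm[of "C u u n" "u n"] by (simp add: m_assoc inv_mult_cancel_left)
  ultimately show "star (star_inv u) u = (\<lambda>_. \<one>)" by (simp add: star_def star_inv_def fun_eq_iff)
qed

definition Q where "Q = \<lparr>carrier = W, mult = star, one = (\<lambda>_. \<one>)\<rparr>"

lemma Q_simps [simp]: "carrier Q = W" "mult Q = star" "one Q = (\<lambda>_. \<one>)"
  by (simp_all add: Q_def)

lemma group_Q: "group Q"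
  by (rule groupI) (use star_inv in \<open>auto simp: star_assoc star_one\<close>)

section \<open>The prefix-product map as an automorphism\<close>

definition T where "T = state_action (cayley_machine G) \<one>"

lemma T_0: "a \<in> W \<Longrightarrow> T a 0 = a 0"
  by (simp add: T_def cayley_action_0)

lemma T_Suc: "a \<in> W \<Longrightarrow> T a (Suc n) = T a n \<otimes> a (Suc n)"
  by (simp add: T_def cayley_action_Suc)

lemma T_W [simp]: "a \<in> W \<Longrightarrow> T a \<in> W"
  using cayley_action_closed[of \<one> a] by (subst omega_words_def) (simp add: T_def)

text \<open>Summation by parts: \<open>T a\<close> is the sequence of partial products of \<open>a\<close>.\<close>

lemma cprod_\<kappa>_T:
  assumes a: "a \<in> W" and w: "\<And>i. i \<le> n \<Longrightarrow> w i \<in> carrier G"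
  shows "cprod (\<lambda>i. \<kappa> (T a i) (w i)) (Suc n) =
    cprod (\<lambda>i. \<kappa> (T a i) (w (Suc i))) n \<otimes> cprod (\<lambda>i. \<kappa> (a i) (w i)) (Suc n)"
  using w
proof (induction n)
  case 0
  then show ?case using a by (simp add: T_0)
next
  case (Suc n)
  let ?P = "cprod (\<lambda>i. \<kappa> (T a i) (w (Suc i))) n" and ?R = "cprod (\<lambda>i. \<kappa> (a i) (w i)) (Suc n)"
  have Z: "?P \<in> Z" "?R \<in> Z" using a Suc.prems by (auto intro!: cprod_Z simp del: cprod.simps)
  have "cprod (\<lambda>i. \<kappa> (T a i) (w i)) (Suc (Suc n)) = ?P \<otimes> ?R \<otimes> \<kappa> (T a (Suc n)) (w (Suc n))"
    using Suc by (subst cprod.simps(2)) simp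
  also have "\<dots> = (?P \<otimes> \<kappa> (T a n) (w (Suc n))) \<otimes> (?R \<otimes> \<kappa> (a (Suc n)) (w (Suc n)))"
    using a Suc.prems Z by (simp add: T_Suc \<kappa>_mult_left m_assoc Z_lcomm del: cprod.simps)
  finally show ?case by simp
qed

text \<open>Adjacent prefix products of \<open>u\<close> differ by the letter
  \<open>u (2 * n - i)\<close>, so the earlier one occurs twice in the pair and its contribution
  squares to \<open>\<one>\<close>.\<close>

lemma C_T:
  assumes "u \<in> W" "a \<in> W"
  shows "C (T u) (T a) n = cprod (\<lambda>i. \<kappa> (T a i) (u (2 * n - i))) n"
  unfolding C_def
proof (rule cprod_cong)
  fix i assume "i < n"
  then have "2 * n - i = Suc (2 * n - 1 - i)" by simp
  then have "T u (2 * n - i) = T u (2 * n - 1 - i) \<otimes> u (2 * n - i)" using assms T_Suc by metis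
  then have "\<kappa> (T a i) (T u (2 * n - 1 - i) \<otimes> T u (2 * n - i))
      = (\<kappa> (T a i) (T u (2 * n - 1 - i)) \<otimes> \<kappa> (T a i) (T u (2 * n - 1 - i))) \<otimes> \<kappa> (T a i) (u (2 * n - i))"
    using assms by (simp add: \<kappa>_mult_right m_assoc)
  then show "\<kappa> (T a i) (T u (2 * n - 1 - i) \<otimes> T u (2 * n - i)) = \<kappa> (T a i) (u (2 * n - i))"
    using assms by (simp add: \<kappa>_twice)
qed

text \<open>In the step to \<open>Suc n\<close> the letter \<open>u (Suc n)\<close> has to pass
  \<open>T a n\<close>; the identity \<open>key\<close> says that the correction terms account for
  exactly this commutator.\<close>

lemma T_star:
  assumes u: "u \<in> W" and a: "a \<in> W"
  shows "T (star u a) = star (T u) (T a)"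
proof
  fix n show "T (star u a) n = star (T u) (T a) n"
  proof (induction n)
    case 0
    have "T (star u a) 0 = star u a 0" using u a by (simp add: T_0)
    also have "star u a 0 = star (T u) (T a) 0" using u a by (simp add: star_def C_def T_0)
    finally show ?case .
  next
    case (Suc n)
    let ?u = "u (Suc n)" and ?a = "a (Suc n)"
    have uW: "u i \<in> carrier G" and aW: "a i \<in> carrier G" and TaW: "T a i \<in> carrier G" for i
      using u a by simp_all
    have Z: "cprod (\<lambda>i. \<kappa> (f i) (g i)) m \<in> Z"
      if "\<And>i. f i \<in> carrier G" "\<And>i. g i \<in> carrier G" for f g m
      using that by (simp add: cprod_Z)
    have "C (T u) (T a) (Suc n) = cprod (\<lambda>i. \<kappa> (T a i) (u (2 * n + 2 - i))) (Suc n)"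
      using u a by (simp add: C_T)
    also have "\<dots> = cprod (\<lambda>i. \<kappa> (T a i) (u (2 * n + 1 - i))) n \<otimes>
        cprod (\<lambda>i. \<kappa> (a i) (u (2 * n + 2 - i))) (Suc n)"
      using cprod_\<kappa>_T[OF a, of n "\<lambda>i. u (2 * n + 2 - i)"] uW by simp
    finally have 1: "C (T u) (T a) (Suc n) = \<dots>" .
    \<comment> \<open>The commutator to be absorbed is the missing last term, as
      \<open>2 * n + 1 - n = Suc n\<close>; summation by parts then applies.\<close>
    have "cprod (\<lambda>i. \<kappa> (T a i) (u (2 * n + 1 - i))) n \<otimes> \<kappa> (T a n) ?u
        = cprod (\<lambda>i. \<kappa> (T a i) (u (2 * n + 1 - i))) (Suc n)"
      by (simp add: Suc_diff_le mult_2)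
    also have "\<dots> = C (T u) (T a) n \<otimes> cprod (\<lambda>i. \<kappa> (a i) (u (2 * n + 1 - i))) (Suc n)"
      using cprod_\<kappa>_T[OF a, of n "\<lambda>i. u (2 * n + 1 - i)"] uW u a by (simp add: C_T)
    finally have 2: "cprod (\<lambda>i. \<kappa> (T a i) (u (2 * n + 1 - i))) n \<otimes> \<kappa> (T a n) ?u = \<dots>" .
    \<comment> \<open>Bimultiplicativity splits the pairs of letters into two products with single
      letters.\<close>
    have 3: "C u a (Suc n) = cprod (\<lambda>i. \<kappa> (a i) (u (2 * n + 1 - i))) (Suc n) \<otimes>
        cprod (\<lambda>i. \<kappa> (a i) (u (2 * n + 2 - i))) (Suc n)"
      unfolding C_def using uW aW
      by (subst cprod_mult[symmetric]) (auto intro!: cprod_cong simp: \<kappa>_mult_right simp del: cprod.simps)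
    \<comment> \<open>Combining 3 with 2 and then 1 trades \<open>C (T u) (T a) n\<close> for the
      commutator and \<open>C (T u) (T a) (Suc n)\<close>.\<close>
    have key: "C (T u) (T a) n \<otimes> C u a (Suc n) = \<kappa> (T a n) ?u \<otimes> C (T u) (T a) (Suc n)"
    proof -
      have "C (T u) (T a) n \<otimes> C u a (Suc n) =
          (C (T u) (T a) n \<otimes> cprod (\<lambda>i. \<kappa> (a i) (u (2 * n + 1 - i))) (Suc n)) \<otimes>
          cprod (\<lambda>i. \<kappa> (a i) (u (2 * n + 2 - i))) (Suc n)"
        unfolding 3 using Z[OF aW uW] u a by (simp add: m_assoc del: cprod.simps)
      also have "\<dots> = \<kappa> (T a n) ?u \<otimes> C (T u) (T a) (Suc n)"
        unfolding 1 2[symmetric] using Z[OF aW uW] Z[OF TaW uW] uW TaW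
        by (simp add: m_assoc Z_lcomm del: cprod.simps)
      finally show ?thesis .
    qed
    have "T (star u a) (Suc n) = (T u n \<otimes> T a n \<otimes> C (T u) (T a) n) \<otimes> (?u \<otimes> ?a \<otimes> C u a (Suc n))"
    proof -
      have "T (star u a) (Suc n) = T (star u a) n \<otimes> star u a (Suc n)" using u a by (simp add: T_Suc)
      then show ?thesis by (simp only: Suc star_def)
    qed
    also have "\<dots> = (C (T u) (T a) n \<otimes> C u a (Suc n)) \<otimes> (T u n \<otimes> (T a n \<otimes> ?u) \<otimes> ?a)"
    proof -
      have "(x \<otimes> y \<otimes> c) \<otimes> (v \<otimes> b \<otimes> d) = (c \<otimes> d) \<otimes> (x \<otimes> (y \<otimes> v) \<otimes> b)"
        if "x \<in> carrier G" "y \<in> carrier G" "v \<in> carrier G" "b \<in> carrier G" "c \<in> Z" "d \<in> Z" for x y v b c d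
      proof -
        have "(x \<otimes> y \<otimes> c) \<otimes> (v \<otimes> b \<otimes> d) = x \<otimes> y \<otimes> (c \<otimes> (d \<otimes> (v \<otimes> b)))"
          using that Z_comm[of d "v \<otimes> b"] by (simp add: m_assoc)
        also have "\<dots> = (c \<otimes> d) \<otimes> (x \<otimes> (y \<otimes> v) \<otimes> b)"
          using that Z_comm[of "c \<otimes> d" "x \<otimes> y"] by (simp add: m_assoc[symmetric])
        finally show ?thesis .
      qed
      then show ?thesis using u a by simp
    qed
    also have "\<dots> = (\<kappa> (T a n) ?u \<otimes> C (T u) (T a) (Suc n)) \<otimes> (T u n \<otimes> (T a n \<otimes> ?u) \<otimes> ?a)"
      unfolding key ..
    also have "\<dots> = C (T u) (T a) (Suc n) \<otimes> (T u n \<otimes> (\<kappa> (T a n) ?u \<otimes> (T a n \<otimes> ?u)) \<otimes> ?a)"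
      using Z_pull[of "\<kappa> (T a n) ?u" "T u n" "T a n \<otimes> (?u \<otimes> ?a)"] u a by (simp add: m_assoc Z_lcomm)
    also have "\<kappa> (T a n) ?u \<otimes> (T a n \<otimes> ?u) = ?u \<otimes> T a n"
      using \<kappa>_swap[of ?u "T a n"] \<kappa>_sym[of "T a n" ?u] u a by simp
    also have "C (T u) (T a) (Suc n) \<otimes> (T u n \<otimes> (?u \<otimes> T a n) \<otimes> ?a) = star (T u) (T a) (Suc n)"
      using u a Z_comm[of "C (T u) (T a) (Suc n)"] by (simp add: star_def T_Suc m_assoc)
    finally show ?case .
  qed
qed


definition T_inv :: "(nat \<Rightarrow> 'a) \<Rightarrow> nat \<Rightarrow> 'a" where
  "T_inv b n = (case n of 0 \<Rightarrow> b 0 | Suc k \<Rightarrow> inv (b k) \<otimes> b (Suc k))"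

lemma T_inv_0: "T_inv b 0 = b 0"
  by (simp add: T_inv_def)

lemma T_inv_Suc: "T_inv b (Suc k) = inv (b k) \<otimes> b (Suc k)"
  by (simp add: T_inv_def)

lemma T_inv_W [simp]: "b \<in> W \<Longrightarrow> T_inv b \<in> W"
  by (subst omega_words_def) (auto simp: T_inv_def split: nat.split)

lemma T_T_inv: "b \<in> W \<Longrightarrow> T (T_inv b) = b"
proof
  fix n assume b: "b \<in> W"
  show "T (T_inv b) n = b n"
    by (induction n) (use b in \<open>simp_all add: T_0 T_Suc T_inv_0 T_inv_Suc mult_inv_cancel_left\<close>)
qed

lemma T_inv_pow_W: "u \<in> W \<Longrightarrow> (T_inv ^^ k) u \<in> W"
  by (induction k) simp_all

lemma T_Bij: "T \<in> Bij W"
  unfolding T_def by (rule cayley_action_Bij) simp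

lemma T_inject: "a \<in> W \<Longrightarrow> b \<in> W \<Longrightarrow> T a = T b \<Longrightarrow> a = b"
  using T_Bij by (auto simp: Bij_def bij_betw_def dest: inj_onD)

section \<open>Finitely supported words\<close>

definition P where "P n = {u \<in> W. \<forall>j\<ge>n. u j = \<one>}"

lemma P_W: "u \<in> P n \<Longrightarrow> u \<in> W"
  by (simp add: P_def)

lemma P_one: "u \<in> P n \<Longrightarrow> n \<le> j \<Longrightarrow> u j = \<one>"
  by (simp add: P_def)

text \<open>At position \<open>j\<close> the correction reads \<open>u\<close> only at positions
  from \<open>j\<close> on. Hence \<open>P n\<close> is closed under \<open>star\<close>, and
  translation by \<open>\<delta> g\<close> leaves the later letters alone.\<close>

lemma C_P:
  assumes "u \<in> P n" "a \<in> W" "n \<le> j"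
  shows "C u a j = \<one>"
  unfolding C_def
proof (rule cprod_one)
  fix i assume "i < j"
  then have "n \<le> 2 * j - 1 - i" "n \<le> 2 * j - i" using assms by auto
  then show "\<kappa> (a i) (u (2 * j - 1 - i) \<otimes> u (2 * j - i)) = \<one>" using assms P_one[OF assms(1)] by simp
qed

lemma subgroup_P: "subgroup (P n) Q"
proof (rule group.subgroupI[OF group_Q])
  show "P n \<subseteq> carrier Q" by (auto simp: P_def)
  have "(\<lambda>_. \<one>) \<in> P n" by (simp add: P_def)
  then show "P n \<noteq> {}" by blast
  fix u assume u: "u \<in> P n"
  have "inv\<^bsub>Q\<^esub> u = star_inv u"
    using star_inv[OF P_W[OF u]] P_W[OF u] by (intro group.inv_equality[OF group_Q]) simp_all
  also have "\<dots> \<in> P n"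
    using star_inv(1)[OF P_W[OF u]] u C_P[OF u P_W[OF u]] P_one[OF u] by (simp add: P_def star_inv_def)
  finally show "inv\<^bsub>Q\<^esub> u \<in> P n" .
  fix v assume v: "v \<in> P n"
  show "u \<otimes>\<^bsub>Q\<^esub> v \<in> P n"
    using P_W[OF u] P_W[OF v] C_P[OF u P_W[OF v]] P_one[OF u] P_one[OF v]
    by (simp add: P_def) (simp add: star_def)
qed

lemma P_I: "u \<in> W \<Longrightarrow> (\<And>j. n \<le> j \<Longrightarrow> u j = \<one>) \<Longrightarrow> u \<in> P n"
  unfolding P_def by blast

lemma T_inv_P:
  assumes u: "u \<in> P n"
  shows "T_inv u \<in> P (Suc n)"
proof (rule P_I)
  show "T_inv u \<in> W" using P_W[OF u] by simp
  fix j assume "Suc n \<le> j"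
  then show "T_inv u j = \<one>" using P_one[OF u] by (cases j) (simp_all add: T_inv_Suc)
qed

lemma card_P: "card (P n) = card (carrier G) ^ n"
proof -
  have "bij_betw (\<lambda>u. restrict u {..<n}) (P n) ({..<n} \<rightarrow>\<^sub>E carrier G)"
  proof (rule bij_betw_byWitness[where f' = "\<lambda>f j. if j < n then f j else \<one>"])
    show "\<forall>u\<in>P n. (\<lambda>j. if j < n then restrict u {..<n} j else \<one>) = u"
      using P_one by (fastforce simp: fun_eq_iff)
    show "\<forall>f\<in>{..<n} \<rightarrow>\<^sub>E carrier G. restrict (\<lambda>j. if j < n then f j else \<one>) {..<n} = f"
      by (auto simp: fun_eq_iff PiE_iff extensional_def)
    show "(\<lambda>u. restrict u {..<n}) ` P n \<subseteq> {..<n} \<rightarrow>\<^sub>E carrier G"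
    proof (rule image_subsetI)
      fix u assume "u \<in> P n"
      then have "u \<in> W" by (rule P_W)
      then show "restrict u {..<n} \<in> {..<n} \<rightarrow>\<^sub>E carrier G" by (simp add: restrict_PiE_iff)
    qed
    show "(\<lambda>f j. if j < n then f j else \<one>) ` ({..<n} \<rightarrow>\<^sub>E carrier G) \<subseteq> P n"
    proof (rule image_subsetI, rule P_I)
      fix f assume f: "f \<in> {..<n} \<rightarrow>\<^sub>E carrier G"
      have "(if j < n then f j else \<one>) \<in> carrier G" for j using PiE_mem[OF f, of j] by simp
      then show "(\<lambda>j. if j < n then f j else \<one>) \<in> W" unfolding omega_words_def by blast
    qed simp
  qed
  then have "card (P n) = card ({..<n} \<rightarrow>\<^sub>E carrier G)" by (rule bij_betw_same_card)
  then show ?thesis by (simp add: card_funcsetE)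
qed

text \<open>The position of the last nontrivial letter increases by one with each application.\<close>

lemma T_inv_pow_degree:
  assumes u: "u \<in> W" and d: "u d \<noteq> \<one>" and above: "\<And>j. j > d \<Longrightarrow> u j = \<one>"
  shows "(T_inv ^^ k) u (d + k) \<noteq> \<one> \<and> (\<forall>j > d + k. (T_inv ^^ k) u j = \<one>)"
proof (induction k)
  case (Suc k)
  let ?v = "(T_inv ^^ k) u"
  have v: "?v \<in> W" using u by (rule T_inv_pow_W)
  have "T_inv ?v (d + Suc k) = inv (?v (d + k))" using Suc v by (simp add: T_inv_Suc)
  moreover have "inv (?v (d + k)) \<noteq> \<one>" using Suc v by simp
  moreover have "T_inv ?v j = \<one>" if "j > d + Suc k" for j
    using that Suc by (cases j) (simp_all add: T_inv_Suc)
  ultimately show ?case by simp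
qed (use d above in simp)

text \<open>The last nontrivial position \<open>d\<close> of \<open>u\<close> would move to
  \<open>d + k\<close>, outside the support allowed by \<open>P k\<close>.\<close>

lemma T_inv_pow_P:
  assumes u: "u \<in> P n" and k: "(T_inv ^^ k) u \<in> P k"
  shows "u = (\<lambda>_. \<one>)"
proof (rule ccontr)
  assume "u \<noteq> (\<lambda>_. \<one>)"
  then obtain j where j: "u j \<noteq> \<one>" by auto
  define d where "d = (GREATEST j. u j \<noteq> \<one>)"
  have bound: "\<And>i. u i \<noteq> \<one> \<Longrightarrow> i \<le> n" using P_one[OF u] nat_le_linear by blast
  have d: "u d \<noteq> \<one>" unfolding d_def using j bound by (rule GreatestI_nat)
  have "u i = \<one>" if "i > d" for i
  proof (rule ccontr)
    assume "u i \<noteq> \<one>"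
    then have "i \<le> d" unfolding d_def using bound by (rule Greatest_le_nat)
    then show False using that by simp
  qed
  then have "(T_inv ^^ k) u (d + k) \<noteq> \<one>" using T_inv_pow_degree[OF P_W[OF u] d] by blast
  then show False using P_one[OF k, of "d + k"] by simp
qed

section \<open>Left translations inside the automata group\<close>

definition L where "L u = (\<lambda>a \<in> W. star u a)"

lemma L_Bij: "u \<in> W \<Longrightarrow> L u \<in> Bij W"
proof -
  assume u: "u \<in> W"
  interpret Q: group Q by (rule group_Q)
  let ?v = "inv\<^bsub>Q\<^esub> u"
  have v: "?v \<in> W" "star ?v u = (\<lambda>_. \<one>)" "star u ?v = (\<lambda>_. \<one>)"
    using u Q.inv_closed[of u] Q.l_inv[of u] Q.r_inv[of u] by simp_all
  have "bij_betw (star u) W W"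
    by (rule bij_betw_byWitness[where f' = "star ?v"])
      (use u v in \<open>auto simp: star_one simp flip: star_assoc\<close>)
  then have "bij_betw (L u) W W" by (rule bij_betw_cong[THEN iffD1, rotated]) (simp add: L_def)
  then show ?thesis by (simp add: Bij_def L_def)
qed

lemma mult_Bij: "f \<in> Bij W \<Longrightarrow> g \<in> Bij W \<Longrightarrow> f \<otimes>\<^bsub>BijGroup W\<^esub> g = compose W f g"
  by (simp add: BijGroup_def)

lemma L_hom: "L \<in> hom Q (BijGroup W)"
proof (rule homI)
  show "L u \<in> carrier (BijGroup W)" if "u \<in> carrier Q" for u
    using that L_Bij by (simp add: BijGroup_def)
  show "L (u \<otimes>\<^bsub>Q\<^esub> v) = L u \<otimes>\<^bsub>BijGroup W\<^esub> L v" if "u \<in> carrier Q" "v \<in> carrier Q" for u v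
    using that by (auto simp: mult_Bij L_Bij fun_eq_iff compose_def) (simp_all add: L_def star_assoc)
qed

lemma L_mult: "u \<in> W \<Longrightarrow> v \<in> W \<Longrightarrow> L (star u v) = L u \<otimes>\<^bsub>BijGroup W\<^esub> L v"
  using hom_mult[OF L_hom, of u v] by simp

lemma L_inject: "u \<in> W \<Longrightarrow> v \<in> W \<Longrightarrow> L u = L v \<longleftrightarrow> u = v"
proof
  assume "u \<in> W" "v \<in> W" "L u = L v"
  then have "L u (\<lambda>_. \<one>) = L v (\<lambda>_. \<one>)" by simp
  then show "u = v" using \<open>u \<in> W\<close> \<open>v \<in> W\<close> by (simp add: L_def star_one)
qed simp

text \<open>The automorphism property of \<open>T\<close> as a relation between bijections:
  conjugating a translation by the inverse of \<open>T\<close> applies \<open>T_inv\<close> to its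
  word.\<close>

lemma T_L: "u \<in> W \<Longrightarrow> T \<otimes>\<^bsub>BijGroup W\<^esub> L (T_inv u) = L u \<otimes>\<^bsub>BijGroup W\<^esub> T"
  by (auto simp: mult_Bij L_Bij T_Bij fun_eq_iff compose_def) (simp add: L_def T_star T_T_inv)

definition \<delta> :: "'a \<Rightarrow> nat \<Rightarrow> 'a" where "\<delta> g n = (if n = 0 then g else \<one>)"

lemma \<delta>_W [simp]: "g \<in> carrier G \<Longrightarrow> \<delta> g \<in> W"
  unfolding omega_words_def \<delta>_def by simp

lemma \<delta>_P: "g \<in> carrier G \<Longrightarrow> \<delta> g \<in> P (Suc 0)"
  by (rule P_I) (simp, simp add: \<delta>_def)

lemma T_\<delta>: "g \<in> carrier G \<Longrightarrow> T (\<delta> g) = (\<lambda>_. g)"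
proof
  fix n assume g: "g \<in> carrier G"
  show "T (\<delta> g) n = g" by (induction n) (use g in \<open>simp_all add: T_0 T_Suc, simp_all add: \<delta>_def\<close>)
qed

lemma star_\<delta>_0: "g \<in> carrier G \<Longrightarrow> a \<in> W \<Longrightarrow> star (\<delta> g) a 0 = g \<otimes> a 0"
  by (simp add: star_def C_def \<delta>_def)

lemma star_\<delta>_Suc:
  assumes "g \<in> carrier G" "a \<in> W"
  shows "star (\<delta> g) a (Suc n) = a (Suc n)"
proof -
  have "C (\<delta> g) a (Suc n) = \<one>" using C_P[OF \<delta>_P[OF assms(1)] assms(2)] by simp
  then show ?thesis using assms by (simp add: star_def) (simp add: \<delta>_def)
qed

lemma state_action_eq:
  assumes g: "g \<in> carrier G"
  shows "state_action (cayley_machine G) g = T \<otimes>\<^bsub>BijGroup W\<^esub> L (\<delta> g)"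
proof -
  have "state_action (cayley_machine G) g a n = T (star (\<delta> g) a) n" if a: "a \<in> W" for a n
  proof (induction n)
    case 0
    have "T (star (\<delta> g) a) 0 = star (\<delta> g) a 0" using a g by (simp add: T_0)
    then show ?case using a g by (simp add: cayley_action_0 star_\<delta>_0)
  next
    case (Suc n)
    have "T (star (\<delta> g) a) (Suc n) = T (star (\<delta> g) a) n \<otimes> star (\<delta> g) a (Suc n)"
      using a g by (simp add: T_Suc)
    then show ?case using a g Suc by (simp add: cayley_action_Suc star_\<delta>_Suc)
  qed
  moreover have "state_action (cayley_machine G) g a = undefined" if "a \<notin> W" for a
    using that by (simp add: state_action_def)
  ultimately show ?thesis
    using g by (simp add: mult_Bij T_Bij L_Bij fun_eq_iff compose_def) (simp add: L_def)
qed

lemma const_W [simp]: "g \<in> carrier G \<Longrightarrow> (\<lambda>_. g) \<in> W"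
  unfolding omega_words_def by simp

text \<open>For a constant word the paired letters multiply to a square, which is central, so the
  correction vanishes.\<close>

lemma star_const:
  assumes "g \<in> carrier G" "a \<in> W"
  shows "star (\<lambda>_. g) a = (\<lambda>n. g \<otimes> a n)"
proof -
  have "C (\<lambda>_. g) a n = \<one>" for n
    unfolding C_def using assms square_central by (intro cprod_one) (simp add: \<kappa>_Z_right)
  then show ?thesis using assms by (simp add: star_def fun_eq_iff)
qed

text \<open>The prefix products of \<open>u\<close> are constantly \<open>g\<close> from
  \<open>n\<close> on, so dividing them by \<open>g\<close> leaves some \<open>w\<close> in
  \<open>P n\<close>. The constant word is \<open>T (\<delta> g)\<close>, and applying the inverse
  of \<open>T\<close> gives the factorization, which builds all of \<open>P\<close> from first
  letters and \<open>T_inv\<close>.\<close>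

lemma P_decompose:
  assumes u: "u \<in> P (Suc n)"
  shows "\<exists>g \<in> carrier G. \<exists>w \<in> P n. u = star (\<delta> g) (T_inv w)"
proof -
  have uW: "u \<in> W" using u by (rule P_W)
  define g where "g = T u n"
  have g: "g \<in> carrier G" using uW by (simp add: g_def)
  have Tu: "T u (n + k) = g" for k
  proof (induction k)
    case (Suc k)
    then show ?case using uW P_one[OF u, of "Suc (n + k)"] g by (simp add: T_Suc)
  qed (simp add: g_def)
  define w where "w = star (\<lambda>_. inv g) (T u)"
  have wW: "w \<in> W" using uW g by (simp add: w_def)
  have "w j = \<one>" if "j \<ge> n" for j
    using that Tu[of "j - n"] g uW by (simp add: w_def star_const)
  then have w: "w \<in> P n" using wW by (simp add: P_def)
  have "T (star (\<delta> g) (T_inv w)) = star (\<lambda>_. g) w"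
    using g wW by (simp add: T_star T_\<delta> T_T_inv)
  also have "\<dots> = T u"
    using g uW wW by (simp add: star_const) (simp add: w_def star_const mult_inv_cancel_left)
  finally have "star (\<delta> g) (T_inv w) = u" using g wW uW by - (rule T_inject, simp_all)
  then show ?thesis using g w by blast
qed

theorem cross_wired:
  assumes fin: "finite (carrier G)" and nontriv: "carrier G \<noteq> {\<one>}"
  shows "cross_wired_lamplighter (automata_group (cayley_machine G))"
proof -
  let ?H = "BijGroup W" and ?S = "state_action (cayley_machine G) ` carrier G"
  let ?\<Gamma> = "subgroup_generated ?H ?S"
  interpret H: group ?H by (rule group_BijGroup)
  interpret \<Gamma>: group ?\<Gamma> by simp
  interpret L: group_hom Q ?H L
    using L_hom group_Q H.group_axioms by (simp add: group_hom_def group_hom_axioms_def)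
  have carrier_H: "carrier ?H = Bij W" by (simp add: BijGroup_def)
  \<comment> \<open>\<open>subgroup_generated\<close> discards generators outside the carrier; here
    none is lost.\<close>
  have SH: "?S \<subseteq> carrier ?H" using cayley_action_Bij by (auto simp: carrier_H)
  have \<Gamma>: "subgroup (carrier ?\<Gamma>) ?H" by (rule H.subgroup_subgroup_generated)
  have S\<Gamma>: "?S \<subseteq> carrier ?\<Gamma>" using SH by (rule H.subgroup_generated_subset_carrier_subset)
  have T\<Gamma>: "T \<in> carrier ?\<Gamma>" using S\<Gamma> by (auto simp: T_def)
  \<comment> \<open>The state \<open>g\<close> acts as \<open>T\<close> times this translation, and
    \<open>T\<close> is itself the action of a state, so it can be cancelled.\<close>
  have \<delta>\<Gamma>: "L (\<delta> g) \<in> carrier ?\<Gamma>" if g: "g \<in> carrier G" for g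
  proof -
    have "T \<otimes>\<^bsub>?H\<^esub> L (\<delta> g) \<in> carrier ?\<Gamma>" using S\<Gamma> g by (auto simp: state_action_eq)
    then have "inv\<^bsub>?H\<^esub> T \<otimes>\<^bsub>?H\<^esub> (T \<otimes>\<^bsub>?H\<^esub> L (\<delta> g)) \<in> carrier ?\<Gamma>"
      using T\<Gamma> \<Gamma> by (simp add: subgroup.m_closed subgroup.m_inv_closed)
    then show ?thesis using g by (simp add: H.inv_mult_cancel_left carrier_H T_Bij L_Bij)
  qed
  \<comment> \<open>Induction along \<open>P_decompose\<close>: translation by
    \<open>T_inv w\<close> is the conjugate of \<open>L w\<close> by the inverse of
    \<open>T\<close>.\<close>
  have P\<Gamma>: "L u \<in> carrier ?\<Gamma>" if "u \<in> P n" for u n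
    using that
  proof (induction n arbitrary: u)
    case 0
    then have "u = \<one>\<^bsub>Q\<^esub>" by (auto simp: P_def)
    then show ?case using L.hom_one subgroup.one_closed[OF \<Gamma>] by simp
  next
    case (Suc n)
    then obtain g w where gw: "g \<in> carrier G" "w \<in> P n" "u = star (\<delta> g) (T_inv w)"
      using P_decompose by blast
    have w: "w \<in> W" using gw P_W by blast
    have "inv\<^bsub>?H\<^esub> T \<otimes>\<^bsub>?H\<^esub> (L w \<otimes>\<^bsub>?H\<^esub> T) \<in> carrier ?\<Gamma>"
      using Suc.IH[OF gw(2)] T\<Gamma> \<Gamma> by (simp add: subgroup.m_closed subgroup.m_inv_closed)
    also have "inv\<^bsub>?H\<^esub> T \<otimes>\<^bsub>?H\<^esub> (L w \<otimes>\<^bsub>?H\<^esub> T) = L (T_inv w)"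
      using w by (simp flip: T_L) (simp add: H.inv_mult_cancel_left carrier_H T_Bij L_Bij)
    finally show ?case
      using \<delta>\<Gamma>[OF gw(1)] gw w \<Gamma> by (simp add: L_mult subgroup.m_closed)
  qed
  have conj: "\<Gamma>.conj_pow T (-1) (L u) = L (T_inv u)" if "u \<in> P n" for u n
    using that P\<Gamma> T\<Gamma> T_inv_P T_L[OF P_W[OF that]] by (intro \<Gamma>.conj_pow_eqI) auto
  have conj_pow: "\<Gamma>.conj_pow T (- int k) (L u) = L ((T_inv ^^ k) u) \<and> (T_inv ^^ k) u \<in> P (n + k)"
    if u: "u \<in> P n" for u n k
  proof (induction k)
    case (Suc k)
    have "\<Gamma>.conj_pow T (- int (Suc k)) (L u) = \<Gamma>.conj_pow T (-1) (\<Gamma>.conj_pow T (- int k) (L u))"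
      using T\<Gamma> P\<Gamma>[OF u] by (simp add: \<Gamma>.conj_pow_add)
    then show ?case
      using Suc conj[of "(T_inv ^^ k) u" "n + k"] T_inv_P[of "(T_inv ^^ k) u" "n + k"] by simp
  qed (use u T\<Gamma> P\<Gamma> in simp)
  interpret expanding_filtration ?\<Gamma> T "\<lambda>n. L ` P n" "card (carrier G)"
  proof (intro expanding_filtration.intro \<Gamma>.group_axioms expanding_filtration_axioms.intro)
    show "T \<in> carrier ?\<Gamma>" by (rule T\<Gamma>)
    show "subgroup (L ` P n) ?\<Gamma>" for n
      using L.subgroup_img_is_subgroup[OF subgroup_P] P\<Gamma> by (auto simp: H.subgroup_subgroup_generated_iff)
    have "card {\<one>} < card (carrier G)" using fin nontriv by (intro psubset_card_mono) auto
    then show "2 \<le> card (carrier G)" by simp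
    have "inj_on L (P n)" for n using L_inject P_W by (auto intro!: inj_onI)
    then show "card (L ` P n) = card (carrier G) ^ n" for n by (simp add: card_image card_P)
    show "L ` P n \<subseteq> L ` P (Suc n)" for n by (auto simp: P_def)
    show "\<Gamma>.conj_pow T (-1) x \<in> L ` P (Suc n)" if "x \<in> L ` P n" for x n
      using that conj T_inv_P by auto
    show "x = \<one>\<^bsub>?\<Gamma>\<^esub>" if x: "x \<in> L ` P n" "\<Gamma>.conj_pow T (- int k) x \<in> L ` P k" for x n k
    proof -
      obtain u v where uv: "u \<in> P n" "x = L u" "v \<in> P k" "L ((T_inv ^^ k) u) = L v"
        using x conj_pow by auto
      then have "(T_inv ^^ k) u = v"
        using L_inject[OF T_inv_pow_W P_W, of u v k k] P_W[OF uv(1)] by blast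
      then have "u = \<one>\<^bsub>Q\<^esub>" using T_inv_pow_P[OF uv(1), of k] uv(3) by simp
      then show ?thesis using uv L.hom_one by simp
    qed
    show "K = carrier ?\<Gamma>" if K: "subgroup K ?\<Gamma>" "T \<in> K" "L ` P 1 \<subseteq> K" for K
    proof
      show "K \<subseteq> carrier ?\<Gamma>" using K(1) subgroup.subset by blast
      have KH: "subgroup K ?H" using K(1) by (simp add: H.subgroup_subgroup_generated_iff)
      \<comment> \<open>Each state is \<open>T\<close> times a translation by
        \<open>\<delta> g\<close>, and \<open>\<delta> g\<close> lies in \<open>P 1\<close>.\<close>
      have "?S \<subseteq> K"
        using K(2,3) \<delta>_P by (auto simp: state_action_eq intro!: subgroup.m_closed[OF KH])
      then show "carrier ?\<Gamma> \<subseteq> K" by (rule H.subgroup_generated_minimal[OF KH])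
    qed
  qed
  have "cross_wired_lamplighter ?\<Gamma>" by (rule cross_wired)
  then show ?thesis by (simp add: automata_group_def)
qed

end

theorem theorem1p4:
  fixes G :: "('a, 'b) monoid_scheme" (structure)
  assumes "group G"
    and "finite (carrier G)"
    and "carrier G \<noteq> {\<one>}"
    and "step2_nilpotent G"
    and "\<And>g. g \<in> carrier G \<Longrightarrow> g [^] (2::nat) \<in> group_center G"
  shows "cross_wired_lamplighter (automata_group (cayley_machine G))"
proof -
  interpret G: group G by fact
  have "square_central_group G"
  proof (intro square_central_group.intro square_central_group_axioms.intro G.group_axioms)
    fix x y assume xy: "x \<in> carrier G" "y \<in> carrier G"
    then show "x \<otimes> y \<otimes> inv x \<otimes> inv y \<in> group_center G"
      using assms(4) unfolding step2_nilpotent_def by blast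
  next
    fix x assume "x \<in> carrier G"
    then show "x \<otimes> x \<in> group_center G" using assms(5)[of x] by (simp add: numeral_2_eq_2)
  qed
  then show ?thesis using assms(2,3) by (rule square_central_group.cross_wired)
qed

end
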